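(* There is an algorithm that, given a melon graph $G=(V,E)$, computes the eternal vertex cover number $\mathrm{evc}(G)$ in $\mathcal{O}(|V|+|E|)$ time.
   Context: Eternal vertex cover: let $G=(V,E)$ be a finite graph and $N[u]$ the closed neighborhood of $u$. For a vertex cover $U$ of $G$ and an edge $e=vw$ of $G$, a defense of $U$ against the attack on $e$ is a one-to-one map $\phi:U\to V$ with $\phi(u)\in N[u]$ for every $u\in U$ such that a guard crosses $e$, i.e. $\phi(v)=w$ (with $v\in U$) or $\phi(w)=v$ (with $w\in U$); $U$ is then said to shift to $\phi(U)$. An eternal vertex cover class of $G$ is a family $\mathcal{U}$ of vertex covers of $G$, all of the same cardinality (the size of $\mathcal{U}$), such that for every $U\in\mathcal{U}$ and every edge $e$ of $G$ there is a defense $\phi$ of $U$ against the attack on $e$ with $\phi(U)\in\mathcal{U}$. The eternal vertex cover number $\mathrm{evc}(G)$ is the minimum size of an eternal vertex cover class of $G$. Melon graphs: for an integer $k\ge 1$, a $k$-melon graph is a graph obtained as the union of $k$ paths $P^{(1)},\dots,P^{(k)}$ (each of length at least $1$), all having the same two distinct endpoints $s$ (source) and $t$ (sink), and pairwise internally vertex-disjoint. A melon graph is a $k$-melon graph for some $k\ge1$. *)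

theory Defs
  imports Main
begin

text \<open>
  Finite simple graphs are given by a vertex set \<open>V\<close> and a set \<open>E\<close> of two-element subsets of \<open>V\<close>.
\<close>

definition vertex_cover :: "'a set \<Rightarrow> 'a set set \<Rightarrow> 'a set \<Rightarrow> bool" where
  "vertex_cover V E U \<longleftrightarrow> U \<subseteq> V \<and> (\<forall>e\<in>E. e \<inter> U \<noteq> {})"

definition closed_nbhd :: "'a set \<Rightarrow> 'a set set \<Rightarrow> 'a \<Rightarrow> 'a set" where
  "closed_nbhd V E u = {v \<in> V. v = u \<or> {u, v} \<in> E}"

definition defense :: "'a set \<Rightarrow> 'a set set \<Rightarrow> 'a set \<Rightarrow> 'a \<Rightarrow> 'a \<Rightarrow> ('a \<Rightarrow> 'a) \<Rightarrow> bool" where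
  "defense V E U v w \<phi> \<longleftrightarrow>
     inj_on \<phi> U \<and> (\<forall>u\<in>U. \<phi> u \<in> closed_nbhd V E u) \<and>
     (v \<in> U \<and> \<phi> v = w \<or> w \<in> U \<and> \<phi> w = v)"

text \<open>
  The family has to be nonempty, since otherwise its size is not defined.
\<close>

definition evc_class :: "'a set \<Rightarrow> 'a set set \<Rightarrow> 'a set set \<Rightarrow> nat \<Rightarrow> bool" where
  "evc_class V E \<U> k \<longleftrightarrow>
     \<U> \<noteq> {} \<and> (\<forall>U\<in>\<U>. vertex_cover V E U \<and> card U = k) \<and>
     (\<forall>U\<in>\<U>. \<forall>v w. {v, w} \<in> E \<longrightarrow> (\<exists>\<phi>. defense V E U v w \<phi> \<and> \<phi> ` U \<in> \<U>))"

definition evc :: "'a set \<Rightarrow> 'a set set \<Rightarrow> nat" where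
  "evc V E = (LEAST k. \<exists>\<U>. evc_class V E \<U> k)"

definition path_edges :: "'a list \<Rightarrow> 'a set set" where
  "path_edges xs = {{xs ! i, xs ! Suc i} | i. Suc i < length xs}"

definition k_melon_graph :: "nat \<Rightarrow> 'a set \<Rightarrow> 'a set set \<Rightarrow> bool" where
  "k_melon_graph k V E \<longleftrightarrow>
     (\<exists>s t P. s \<noteq> t \<and>
        (\<forall>i<k. distinct (P i) \<and> length (P i) \<ge> 2 \<and> hd (P i) = s \<and> last (P i) = t) \<and>
        (\<forall>i<k. \<forall>j<k. i \<noteq> j \<longrightarrow> set (P i) \<inter> set (P j) = {s, t}) \<and>
        V = (\<Union>i<k. set (P i)) \<and> E = (\<Union>i<k. path_edges (P i)))"

definition melon_graph :: "'a set \<Rightarrow> 'a set set \<Rightarrow> bool" where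
  "melon_graph V E \<longleftrightarrow> (\<exists>k\<ge>1. k_melon_graph k V E)"

text \<open>
  The set \<open>{V}\<close> is an eternal vertex cover class, so the minimum defining \<^const>\<open>evc\<close> exists.
\<close>

lemma evc_class_all_vertices:
  assumes "\<And>e. e \<in> E \<Longrightarrow> \<exists>u v. u \<noteq> v \<and> u \<in> V \<and> v \<in> V \<and> e = {u, v}"
  shows "evc_class V E {V} (card V)"
proof -
  have "\<exists>\<phi>. defense V E V v w \<phi> \<and> \<phi> ` V = V" if e: "{v, w} \<in> E" for v w
  proof -
    have vw: "v \<in> V" "w \<in> V" using assms[OF e] by (auto simp: doubleton_eq_iff)
    define \<phi> where "\<phi> = id(v := w, w := v)"
    have "defense V E V v w \<phi>"
      using vw e by (auto simp: defense_def closed_nbhd_def \<phi>_def inj_on_def insert_commute)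
    moreover have "\<phi> ` V = V" using vw by (auto simp: \<phi>_def image_iff)
    ultimately show ?thesis by blast
  qed
  moreover have "vertex_cover V E V" using assms by (fastforce simp: vertex_cover_def)
  ultimately show ?thesis by (simp add: evc_class_def)
qed

text \<open>
  The machine model is a unit-cost random access machine with registers, a memory that is
  addressed indirectly through registers, and addition and truncated subtraction as its only
  arithmetic. Programs are structured; they translate into jump programs with constant overhead
  per executed instruction.
  Words are bounded: a step writing a value \<open>\<ge> W\<close> has no semantics, so such a run gets stuck.
\<close>

datatype com =
    Skip
  | Const nat nat
  | Move nat nat
  | Add nat nat nat
  | Sub nat nat nat
  | Load nat nat
  | Store nat nat
  | Seq com com
  | IfNZ nat com com
  | WhileNZ nat com

type_synonym state = "(nat \<Rightarrow> nat) \<times> (nat \<Rightarrow> nat)"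

text \<open>
  \<open>exec W p \<sigma> n \<sigma>'\<close>: with all written words below \<open>W\<close>, the program \<open>p\<close> started in \<open>\<sigma>\<close>
  halts in \<open>\<sigma>'\<close> after \<open>n\<close> steps. A state consists of the registers and the memory.
\<close>

inductive exec :: "nat \<Rightarrow> com \<Rightarrow> state \<Rightarrow> nat \<Rightarrow> state \<Rightarrow> bool" for W :: nat where
  Skip: "exec W Skip \<sigma> 1 \<sigma>"
| Const: "c < W \<Longrightarrow> exec W (Const x c) (r, h) 1 (r(x := c), h)"
| Move: "r y < W \<Longrightarrow> exec W (Move x y) (r, h) 1 (r(x := r y), h)"
| Add: "r y + r z < W \<Longrightarrow> exec W (Add x y z) (r, h) 1 (r(x := r y + r z), h)"
| Sub: "r y - r z < W \<Longrightarrow> exec W (Sub x y z) (r, h) 1 (r(x := r y - r z), h)"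
| Load: "h (r y) < W \<Longrightarrow> exec W (Load x y) (r, h) 1 (r(x := h (r y)), h)"
| Store: "r y < W \<Longrightarrow> exec W (Store x y) (r, h) 1 (r, h(r x := r y))"
| Seq: "exec W p \<sigma> m \<sigma>' \<Longrightarrow> exec W q \<sigma>' n \<sigma>'' \<Longrightarrow> exec W (Seq p q) \<sigma> (m + n) \<sigma>''"
| IfTrue: "fst \<sigma> x \<noteq> 0 \<Longrightarrow> exec W p \<sigma> n \<sigma>' \<Longrightarrow> exec W (IfNZ x p q) \<sigma> (1 + n) \<sigma>'"
| IfFalse: "fst \<sigma> x = 0 \<Longrightarrow> exec W q \<sigma> n \<sigma>' \<Longrightarrow> exec W (IfNZ x p q) \<sigma> (1 + n) \<sigma>'"
| WhileFalse: "fst \<sigma> x = 0 \<Longrightarrow> exec W (WhileNZ x p) \<sigma> 1 \<sigma>"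
| WhileTrue: "fst \<sigma> x \<noteq> 0 \<Longrightarrow> exec W p \<sigma> m \<sigma>' \<Longrightarrow> exec W (WhileNZ x p) \<sigma>' n \<sigma>'' \<Longrightarrow>
    exec W (WhileNZ x p) \<sigma> (1 + m + n) \<sigma>''"

inductive_cases exec_SkipE: "exec W Skip \<sigma> n \<sigma>'"
inductive_cases exec_ConstE: "exec W (Const x c) (r, h) n \<sigma>'"
inductive_cases exec_MoveE: "exec W (Move x y) (r, h) n \<sigma>'"
inductive_cases exec_AddE: "exec W (Add x y z) (r, h) n \<sigma>'"
inductive_cases exec_SubE: "exec W (Sub x y z) (r, h) n \<sigma>'"
inductive_cases exec_LoadE: "exec W (Load x y) (r, h) n \<sigma>'"
inductive_cases exec_StoreE: "exec W (Store x y) (r, h) n \<sigma>'"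
inductive_cases exec_SeqE: "exec W (Seq p q) \<sigma> n \<sigma>'"
inductive_cases exec_IfNZE: "exec W (IfNZ x p q) \<sigma> n \<sigma>'"
inductive_cases exec_WhileNZE: "exec W (WhileNZ x p) \<sigma> n \<sigma>'"

lemma exec_deterministic:
  "exec W p \<sigma> m \<sigma>' \<Longrightarrow> exec W p \<sigma> n \<sigma>'' \<Longrightarrow> n = m \<and> \<sigma>'' = \<sigma>'"
proof (induction arbitrary: n \<sigma>'' rule: exec.induct)
  case Skip
  from Skip.prems show ?case by (rule exec_SkipE) simp
next
  case Const
  from Const.prems show ?case by (rule exec_ConstE) simp
next
  case Move
  from Move.prems show ?case by (rule exec_MoveE) simp
next
  case Add
  from Add.prems show ?case by (rule exec_AddE) simp
next
  case Sub
  from Sub.prems show ?case by (rule exec_SubE) simp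
next
  case Load
  from Load.prems show ?case by (rule exec_LoadE) simp
next
  case Store
  from Store.prems show ?case by (rule exec_StoreE) simp
next
  case (Seq p \<sigma> m \<sigma>' q k \<tau>)
  from Seq.prems obtain m' \<rho> n' where
    *: "n = m' + n'" "exec W p \<sigma> m' \<rho>" "exec W q \<rho> n' \<sigma>''"
    by (rule exec_SeqE)
  from Seq.IH(1)[OF *(2)] have "m' = m" "\<rho> = \<sigma>'" by simp_all
  with Seq.IH(2) *(1,3) show ?case by blast
next
  case (IfTrue \<sigma> x p k \<sigma>' q)
  from IfTrue.prems obtain n' where *: "n = 1 + n'" "exec W p \<sigma> n' \<sigma>''"
    by (rule exec_IfNZE) (use IfTrue.hyps(1) in simp_all)
  with IfTrue.IH show ?case by blast
next
  case (IfFalse \<sigma> x q k \<sigma>' p)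
  from IfFalse.prems obtain n' where *: "n = 1 + n'" "exec W q \<sigma> n' \<sigma>''"
    by (rule exec_IfNZE) (use IfFalse.hyps(1) in simp_all)
  with IfFalse.IH show ?case by blast
next
  case WhileFalse
  from WhileFalse.prems show ?case by (rule exec_WhileNZE) (use WhileFalse.hyps in simp_all)
next
  case (WhileTrue \<sigma> x p m \<sigma>' k \<tau>)
  from WhileTrue.prems obtain m' \<rho> n' where
    *: "n = 1 + m' + n'" "exec W p \<sigma> m' \<rho>" "exec W (WhileNZ x p) \<rho> n' \<sigma>''"
    by (rule exec_WhileNZE) (use WhileTrue.hyps(1) in simp_all)
  from WhileTrue.IH(1)[OF *(2)] have "m' = m" "\<rho> = \<sigma>'" by simp_all
  with WhileTrue.IH(2) *(1,3) show ?case by blast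
qed

text \<open>
  The vertices are numbered in an arbitrary way by the list \<open>vs\<close>, and \<open>adj ! i\<close> lists the numbers
  of the neighbours of \<open>vs ! i\<close> in an arbitrary order.
\<close>

definition adjacency_lists :: "'a set \<Rightarrow> 'a set set \<Rightarrow> 'a list \<Rightarrow> nat list list \<Rightarrow> bool" where
  "adjacency_lists V E vs adj \<longleftrightarrow>
     distinct vs \<and> set vs = V \<and> length adj = length vs \<and>
     (\<forall>i<length vs. distinct (adj ! i) \<and>
        set (adj ! i) = {j. j < length vs \<and> {vs ! i, vs ! j} \<in> E})"

text \<open>
  Memory layout of the input, with \<open>n\<close> the number of vertices: cell \<open>0\<close> holds \<open>n\<close>, cells
  \<open>1, \<dots>, n + 1\<close> hold addresses, and the adjacency lists follow consecutively; the list of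
  vertex number \<open>i\<close> starts at the address in cell \<open>i + 1\<close> and ends before the one in cell \<open>i + 2\<close>.
\<close>

definition encoding :: "nat list list \<Rightarrow> nat list" where
  "encoding adj =
     length adj #
     map (\<lambda>i. length adj + 2 + length (concat (take i adj))) [0..<length adj + 1] @
     concat adj"

definition input_state :: "nat list list \<Rightarrow> state" where
  "input_state adj =
     (\<lambda>_. 0, \<lambda>a. if a < length (encoding adj) then encoding adj ! a else 0)"

definition result :: "state \<Rightarrow> nat" where
  "result \<sigma> = fst \<sigma> 0"

end

theory Submission
  imports Defs
begin

text \<open>
  Let a melon graph have \<open>n\<close> vertices and \<open>k\<close> paths, \<open>e\<close> of them of even length. Its eternal vertex
  cover number is \<open>n - 1\<close> if \<open>k = 1\<close>, \<open>n / 2\<close> rounded up if \<open>k = 2\<close>, and for \<open>k \<ge> 3\<close> it is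
  \<open>(n + e) / 2\<close> if \<open>e \<le> 1\<close> and \<open>(n + 4 - e) / 2\<close> if \<open>e \<ge> 2\<close>.

  For the upper bounds all guard configurations have a fixed parity on the interior of each path: the
  guards stand on all odd or on all even positions. A defense shifts all guards inside some paths one
  step towards the sink and inside some other paths one step towards the source; a guard entering \<open>s\<close>
  or \<open>t\<close> from one path releases the guard there into another one. For \<open>e \<ge> 2\<close> both \<open>s\<close> and \<open>t\<close> stay
  occupied and exactly one even path carries a surplus guard, which moves on to another even path.

  For the lower bounds, matchings inside the paths bound the size of a vertex cover in terms of the
  guards on \<open>s\<close> and \<open>t\<close>. If \<open>e \<ge> 2\<close> and \<open>k \<ge> 3\<close>, a minimum vertex cover contains \<open>s\<close> and \<open>t\<close> and
  no neighbour of \<open>s\<close> on an even path, so an attack on such an edge cannot be answered within minimum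
  covers. On a single path, successive attacks on the first unguarded vertex fill all but the last one.

  The program reads \<open>k\<close> off the total length of the adjacency lists. If \<open>k \<ge> 3\<close>, the endpoints are
  the vertices of degree at least three, and walking along all paths from one of them yields \<open>e\<close>.
\<close>

subsection \<open>Melon graphs as families of indexed paths\<close>

locale melon =
  fixes I :: "'i set" and len :: "'i \<Rightarrow> nat" and x :: "'i \<Rightarrow> nat \<Rightarrow> 'v" and s t :: 'v
  assumes finite_I: "finite I" and I_nonempty: "I \<noteq> {}" and s_neq_t: "s \<noteq> t"
    and len_pos: "i \<in> I \<Longrightarrow> 0 < len i"
    and x_0: "i \<in> I \<Longrightarrow> x i 0 = s" and x_len: "i \<in> I \<Longrightarrow> x i (len i) = t"
    and x_inner: "i \<in> I \<Longrightarrow> 0 < j \<Longrightarrow> j < len i \<Longrightarrow> x i j \<noteq> s \<and> x i j \<noteq> t"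
    and x_inj: "i \<in> I \<Longrightarrow> i' \<in> I \<Longrightarrow> 0 < j \<Longrightarrow> j < len i \<Longrightarrow> 0 < j' \<Longrightarrow> j' < len i' \<Longrightarrow>
      x i j = x i' j' \<Longrightarrow> i = i' \<and> j = j'"
begin

definition inner :: "'i \<Rightarrow> 'v set" where
  "inner i = x i ` {0<..<len i}"

definition verts :: "'v set" where
  "verts = {s, t} \<union> (\<Union>i\<in>I. inner i)"

definition edges :: "'v set set" where
  "edges = {{x i j, x i (Suc j)} | i j. i \<in> I \<and> j < len i}"

lemma x_in_verts: "i \<in> I \<Longrightarrow> j \<le> len i \<Longrightarrow> x i j \<in> verts"
  by (cases "j = 0"; cases "j = len i")
    (auto simp: verts_def inner_def x_0 x_len intro!: bexI[of _ i] imageI)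

text \<open>Interior vertices occur at one position of one path only, whereas \<open>s\<close> and
  \<open>t\<close> lie on all paths. So it is enough that one of the two compared positions is
  interior; the other may be an endpoint.\<close>

lemma x_eq_iff:
  assumes "i \<in> I" "0 < j" "j < len i" "i' \<in> I" "j' \<le> len i'"
  shows "x i j = x i' j' \<longleftrightarrow> i = i' \<and> j = j'"
proof (cases "j' = 0 \<or> j' = len i'")
  case True
  then show ?thesis using assms x_inner[OF assms(1-3)] x_0[of i'] x_len[of i'] by auto
next
  case False
  then show ?thesis using assms x_inj[of i i' j j'] by auto
qed

lemma x_eq_iff':
  assumes "i \<in> I" "0 < j" "j < len i" "i' \<in> I" "j' \<le> len i'"
  shows "x i' j' = x i j \<longleftrightarrow> i = i' \<and> j = j'"
  using x_eq_iff[OF assms] by metis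

lemma x_eq_s_iff: "i \<in> I \<Longrightarrow> j \<le> len i \<Longrightarrow> x i j = s \<longleftrightarrow> j = 0"
  by (metis x_0 x_len x_inner s_neq_t le_neq_implies_less neq0_conv)

lemma x_eq_t_iff: "i \<in> I \<Longrightarrow> j \<le> len i \<Longrightarrow> x i j = t \<longleftrightarrow> j = len i"
  by (metis x_0 x_len x_inner s_neq_t le_neq_implies_less neq0_conv)

lemma edgeI: "i \<in> I \<Longrightarrow> j < len i \<Longrightarrow> {x i j, x i (Suc j)} \<in> edges"
  unfolding edges_def by blast

lemma edges_in_verts: "e \<in> edges \<Longrightarrow> \<exists>u v. u \<noteq> v \<and> u \<in> verts \<and> v \<in> verts \<and> e = {u, v}"
proof -
  assume "e \<in> edges"
  then obtain i j where ij: "i \<in> I" "j < len i" "e = {x i j, x i (Suc j)}"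
    by (auto simp: edges_def)
  have "x i j \<noteq> x i (Suc j)"
    using ij x_eq_s_iff[of i "Suc j"] x_eq_iff[of i j i "Suc j"] x_0[of i] by (cases "j = 0") auto
  then show ?thesis using ij x_in_verts[of i j] x_in_verts[of i "Suc j"] by auto
qed

lemma finite_inner [simp]: "finite (inner i)"
  by (simp add: inner_def)

lemma inner_disjoint: "i \<in> I \<Longrightarrow> i' \<in> I \<Longrightarrow> i \<noteq> i' \<Longrightarrow> inner i \<inter> inner i' = {}"
  using x_inj by (fastforce simp: inner_def)

lemma s_notin_inner: "i \<in> I \<Longrightarrow> s \<notin> inner i" and t_notin_inner: "i \<in> I \<Longrightarrow> t \<notin> inner i"
  using x_inner[of i] by (auto simp: inner_def image_iff) metis+

lemma inj_on_inner: "i \<in> I \<Longrightarrow> inj_on (x i) {0<..<len i}"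
  using x_inj by (auto simp: inj_on_def)

lemma finite_verts: "finite verts"
  using finite_I by (simp add: verts_def)

lemma card_subset_verts:
  assumes "U \<subseteq> verts"
  shows "card U = card (U \<inter> {s, t}) + (\<Sum>i\<in>I. card (U \<inter> inner i))"
proof -
  have U: "U = (U \<inter> {s, t}) \<union> (\<Union>i\<in>I. U \<inter> inner i)" using assms by (auto simp: verts_def)
  have "card U = card (U \<inter> {s, t}) + card (\<Union>i\<in>I. U \<inter> inner i)"
    by (subst U, rule card_Un_disjoint)
      (use finite_I s_notin_inner t_notin_inner in \<open>auto simp: Int_Un_distrib\<close>)
  also have "card (\<Union>i\<in>I. U \<inter> inner i) = (\<Sum>i\<in>I. card (U \<inter> inner i))"
    by (rule card_UN_disjoint) (use finite_I inner_disjoint in \<open>simp, simp, blast\<close>)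
  finally show ?thesis .
qed

lemma card_verts: "card verts = 2 + (\<Sum>i\<in>I. len i - 1)"
proof -
  have "card (verts \<inter> inner i) = len i - 1" if "i \<in> I" for i
  proof -
    have "verts \<inter> inner i = inner i" using that by (auto simp: verts_def)
    then show ?thesis using inj_on_inner[OF that] by (simp add: inner_def card_image)
  qed
  moreover have "verts \<inter> {s, t} = {s, t}" by (auto simp: verts_def)
  ultimately show ?thesis using card_subset_verts[of verts] s_neq_t by simp
qed

definition evens :: "'i set" where
  "evens = {i \<in> I. even (len i)}"

subsection \<open>States of constant parity along each path\<close>

definition pstate :: "bool \<Rightarrow> bool \<Rightarrow> ('i \<Rightarrow> bool) \<Rightarrow> 'v set" where
  "pstate a b f = {v. v = s \<and> a \<or> v = t \<and> b} \<union>
     {x i j | i j. i \<in> I \<and> 0 < j \<and> j < len i \<and> odd j = f i}"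

lemma pstate_inner: "i \<in> I \<Longrightarrow> 0 < j \<Longrightarrow> j < len i \<Longrightarrow> x i j \<in> pstate a b f \<longleftrightarrow> odd j = f i"
  using x_inner[of i j] x_inj[of i _ j] by (simp add: pstate_def) metis

lemma pstate_s: "s \<in> pstate a b f \<longleftrightarrow> a" and pstate_t: "t \<in> pstate a b f \<longleftrightarrow> b"
  using x_inner s_neq_t by (simp_all add: pstate_def) metis+

lemma pstate_subset: "pstate a b f \<subseteq> verts"
  by (auto simp: pstate_def verts_def inner_def)

lemma pstate_cases:
  assumes "v \<in> pstate a b f"
  obtains "v = s" a | "v = t" b
    | i j where "v = x i j" "i \<in> I" "0 < j" "j < len i" "odd j = f i"
  using assms by (auto simp: pstate_def)

text \<open>For odd \<open>l\<close> the odd and the even positions strictly between 0 and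
  \<open>l\<close> are equally many; for even \<open>l\<close> there is one more odd position.
  Doubling the count and adding each correction on its own side avoids halves and truncated
  subtraction.\<close>

lemma card_parity_interval:
  "2 * card {j. 0 < j \<and> j < l \<and> odd j = c} + (if even l \<and> \<not> c then 1 else 0)
    = (l - 1) + (if even l \<and> c then 1 else 0)" if "0 < l" for l :: nat
  using that
proof (induction l rule: nat_induct_non_zero)
  case 1
  have "{j::nat. 0 < j \<and> j < 1 \<and> odd j = c} = {}" by auto
  then show ?case by simp
next
  case (Suc l)
  have "{j. 0 < j \<and> j < Suc l \<and> odd j = c} =
      (if odd l = c then insert l else id) {j. 0 < j \<and> j < l \<and> odd j = c}"
    using Suc.hyps less_Suc_eq by auto
  moreover have "finite {j. 0 < j \<and> j < l \<and> odd j = c}" by simp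
  ultimately have "card {j. 0 < j \<and> j < Suc l \<and> odd j = c} =
      card {j. 0 < j \<and> j < l \<and> odd j = c} + (if odd l = c then 1 else 0)"
    by simp
  with Suc show ?case by (auto split: if_splits)
qed

text \<open>An odd path carries half of its interior for either parity, so moving its guards costs
  nothing; an even path carries one guard more on its odd positions than on its even ones. This
  balance dictates the invariants of all the classes below.\<close>

lemma card_pstate:
  "2 * card (pstate a b f) + 2 + card {i \<in> evens. \<not> f i} =
     card verts + 2 * (of_bool a + of_bool b) + card {i \<in> evens. f i}"
proof -
  let ?U = "pstate a b f"
  have inn: "card (?U \<inter> inner i) = card {j. 0 < j \<and> j < len i \<and> odd j = f i}" if "i \<in> I" for i
  proof -
    have "?U \<inter> inner i = x i ` {j. 0 < j \<and> j < len i \<and> odd j = f i}"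
      using pstate_inner[OF that] by (auto simp: inner_def)
    moreover have "inj_on (x i) {j. 0 < j \<and> j < len i \<and> odd j = f i}"
      by (rule inj_on_subset[OF inj_on_inner[OF that]]) auto
    ultimately show ?thesis by (simp add: card_image)
  qed
  have st: "card (?U \<inter> {s, t}) = of_bool a + of_bool b"
  proof -
    have "?U \<inter> {s, t} = (if a then {s} else {}) \<union> (if b then {t} else {})"
      by (auto simp: pstate_s pstate_t)
    then show ?thesis using s_neq_t by simp
  qed
  have cnt: "card {i \<in> evens. Q i} = (\<Sum>i\<in>I. if even (len i) \<and> Q i then 1 else 0)" for Q
    using finite_I by (simp add: evens_def sum.If_cases Int_def conj_ac)
  have "2 * (\<Sum>i\<in>I. card (?U \<inter> inner i)) + card {i \<in> evens. \<not> f i}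
      = (\<Sum>i\<in>I. 2 * card {j. 0 < j \<and> j < len i \<and> odd j = f i}
          + (if even (len i) \<and> \<not> f i then 1 else 0))"
    by (simp add: inn cnt sum.distrib sum_distrib_left cong: sum.cong)
  also have "\<dots> = (\<Sum>i\<in>I. (len i - 1) + (if even (len i) \<and> f i then 1 else 0))"
    by (rule sum.cong) (use card_parity_interval len_pos in blast)+
  also have "\<dots> + 2 = card verts + card {i \<in> evens. f i}"
    by (simp add: card_verts cnt sum.distrib)
  finally show ?thesis using card_subset_verts[OF pstate_subset[of a b f]] st by simp
qed

text \<open>Alternation covers every edge between two interior vertices, so only the first and the
  last edge of each path impose conditions. On a path of length one these are the same edge, between
  \<open>s\<close> and \<open>t\<close>.\<close>

lemma vertex_cover_pstate:
  assumes "\<And>i. i \<in> I \<Longrightarrow> a \<or> (f i \<and> 1 < len i) \<or> (b \<and> len i = 1)"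
    and "\<And>i. i \<in> I \<Longrightarrow> b \<or> (odd (len i) \<noteq> f i \<and> 1 < len i) \<or> (a \<and> len i = 1)"
  shows "vertex_cover verts edges (pstate a b f)"
  unfolding vertex_cover_def
proof (intro conjI ballI pstate_subset)
  fix e assume "e \<in> edges"
  then obtain i j where ij: "i \<in> I" "j < len i" "e = {x i j, x i (Suc j)}"
    by (auto simp: edges_def)
  note a1 = assms(1)[OF ij(1)] and a2 = assms(2)[OF ij(1)]
  have "x i j \<in> pstate a b f \<or> x i (Suc j) \<in> pstate a b f"
  proof (cases "j = 0"; cases "Suc j = len i")
    assume "j = 0" "Suc j = len i"
    then show ?thesis using x_0[OF ij(1)] x_len[OF ij(1)] a1 by (auto simp: pstate_s pstate_t)
  next
    assume "j = 0" "Suc j \<noteq> len i"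
    then show ?thesis using x_0[OF ij(1)] a1 ij pstate_inner[OF ij(1), of 1 a b f]
      by (auto simp: pstate_s pstate_t)
  next
    assume j: "j \<noteq> 0" "Suc j = len i"
    moreover from j have "x i (Suc j) = t" "odd j \<longleftrightarrow> even (len i)"
      using x_len[OF ij(1)] by (simp, metis even_Suc)
    ultimately show ?thesis
      using a2 ij pstate_inner[OF ij(1), of j a b f] by (auto simp: pstate_s pstate_t)
  next
    assume "j \<noteq> 0" "Suc j \<noteq> len i"
    then show ?thesis using ij pstate_inner[OF ij(1), of j a b f] pstate_inner[OF ij(1), of "Suc j" a b f]
      by auto
  qed
  then show "e \<inter> pstate a b f \<noteq> {}" using ij by auto
qed

text \<open>
  A legal shift moves every guard inside a path of \<open>R\<close> one step towards \<open>t\<close> and every guard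
  inside a path of \<open>L\<close> one step towards \<open>s\<close>. The options name the paths through which a guard
  leaves \<open>s\<close>, enters \<open>s\<close>, leaves \<open>t\<close> and enters \<open>t\<close>.
\<close>

definition legal_shift :: "bool \<Rightarrow> bool \<Rightarrow> ('i \<Rightarrow> bool) \<Rightarrow> 'i set \<Rightarrow> 'i set \<Rightarrow>
    'i option \<Rightarrow> 'i option \<Rightarrow> 'i option \<Rightarrow> 'i option \<Rightarrow> bool" where
  "legal_shift a b f R L so si tt ti \<longleftrightarrow>
     R \<subseteq> I \<and> L \<subseteq> I \<and> R \<inter> L = {} \<and>
     {i \<in> R. \<not> f i} = set_option so \<and> {i \<in> L. f i} = set_option si \<and>
     {i \<in> L. odd (len i) = f i} = set_option tt \<and> {i \<in> R. odd (len i) \<noteq> f i} = set_option ti \<and>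
     (so \<noteq> None \<longrightarrow> a) \<and> (tt \<noteq> None \<longrightarrow> b) \<and>
     (si \<noteq> None \<and> a \<longrightarrow> so \<noteq> None) \<and> (ti \<noteq> None \<and> b \<longrightarrow> tt \<noteq> None)"

text \<open>The last part of \<open>ij\<close> puts a guard on that end of the attacked edge from
  which path \<open>i\<close> moves across it. Guards do not collide, since the options name at most
  one path for each passage and an occupied endpoint is vacated whenever a guard enters it.\<close>

lemma defense_legal_shift:
  assumes leg: "legal_shift a b f R L so si tt ti"
    and a': "a' = (si \<noteq> None \<or> a \<and> so = None)" and b': "b' = (ti \<noteq> None \<or> b \<and> tt = None)"
    and f': "f' = (\<lambda>i. f i \<noteq> (i \<in> R \<union> L))"
    and card: "card (pstate a b f) = card (pstate a' b' f')"
    and ij: "i \<in> I" "j < len i" "i \<in> R \<and> odd j = f i \<or> i \<in> L \<and> even j = f i"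
  shows "\<exists>\<phi>. defense verts edges (pstate a b f) (x i j) (x i (Suc j)) \<phi> \<and>
    \<phi> ` pstate a b f = pstate a' b' f'"
proof -
  let ?U = "pstate a b f" and ?U' = "pstate a' b' f'"
  from leg have RL: "R \<subseteq> I" "L \<subseteq> I" "R \<inter> L = {}"
    and so: "\<And>i. (i \<in> R \<and> \<not> f i) \<longleftrightarrow> so = Some i" and si: "\<And>i. (i \<in> L \<and> f i) \<longleftrightarrow> si = Some i"
    and tt: "\<And>i. (i \<in> L \<and> odd (len i) = f i) \<longleftrightarrow> tt = Some i"
    and ti: "\<And>i. (i \<in> R \<and> odd (len i) \<noteq> f i) \<longleftrightarrow> ti = Some i"
    and ab: "so \<noteq> None \<longrightarrow> a" "tt \<noteq> None \<longrightarrow> b" "si \<noteq> None \<and> a \<longrightarrow> so \<noteq> None"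
      "ti \<noteq> None \<and> b \<longrightarrow> tt \<noteq> None"
    unfolding legal_shift_def by (auto simp: set_eq_iff)
  define step where "step i j = (if i \<in> R then Suc j else if i \<in> L then j - 1 else j)" for i j
  \<comment> \<open>For an interior vertex the \<open>THE\<close> has exactly one candidate, because
    \<open>x_inj\<close> recovers the position from the vertex.\<close>
  define \<phi> where "\<phi> v = (if v = s then (case so of Some i \<Rightarrow> x i 1 | None \<Rightarrow> s)
     else if v = t then (case tt of Some i \<Rightarrow> x i (len i - 1) | None \<Rightarrow> t)
     else (THE w. \<exists>i j. i \<in> I \<and> 0 < j \<and> j < len i \<and> v = x i j \<and> w = x i (step i j)))" for v
  have \<phi>x: "\<phi> (x i j) = x i (step i j)" if "i \<in> I" "0 < j" "j < len i" for i j
  proof -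
    have "(THE w. \<exists>i' j'. i' \<in> I \<and> 0 < j' \<and> j' < len i' \<and> x i j = x i' j' \<and> w = x i' (step i' j'))
        = x i (step i j)"
      by (rule the_equality) (use that x_inj in blast)+
    then show ?thesis using x_inner[OF that] by (simp add: \<phi>_def)
  qed
  have \<phi>s: "\<phi> s = (case so of Some i \<Rightarrow> x i 1 | None \<Rightarrow> s)" by (simp add: \<phi>_def)
  have \<phi>t: "\<phi> t = (case tt of Some i \<Rightarrow> x i (len i - 1) | None \<Rightarrow> t)"
    using s_neq_t by (simp add: \<phi>_def)
  have step: "step i j \<le> len i" "step i j = 0 \<longleftrightarrow> i \<in> L \<and> j = 1"
    "step i j = len i \<longleftrightarrow> i \<in> R \<and> Suc j = len i" "odd (step i j) = (odd j \<noteq> (i \<in> R \<union> L))"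
    if "i \<in> I" "0 < j" "j < len i" for i j
    using that RL by (auto simp: step_def)
  have nbh: "x i j' \<in> closed_nbhd verts edges (x i j)" 
    if "i \<in> I" "j \<le> len i" "j' \<le> len i" "j' = j \<or> j' = Suc j \<or> j = Suc j'" for i j j'
    using that x_in_verts[OF that(1)] 
    by (auto simp: closed_nbhd_def edges_def insert_commute Suc_le_eq)
  have legal: "\<phi> v \<in> closed_nbhd verts edges v" if "v \<in> ?U" for v
    using that
  proof (cases rule: pstate_cases)
    case 1
    show ?thesis
    proof (cases so)
      case None
      then show ?thesis using 1 \<phi>s by (auto simp: closed_nbhd_def verts_def)
    next
      case (Some p)
      then have "p \<in> I" using so RL by blast
      then show ?thesis using 1 \<phi>s Some nbh[of p 0 1] len_pos[of p] x_0[of p] by simp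
    qed
  next
    case 2
    show ?thesis
    proof (cases tt)
      case None
      then show ?thesis using 2 \<phi>t by (auto simp: closed_nbhd_def verts_def)
    next
      case (Some p)
      then have "p \<in> I" using tt RL by blast
      then show ?thesis using 2 \<phi>t Some nbh[of p "len p" "len p - 1"] len_pos[of p] x_len[of p] by simp
    qed
  next
    case (3 i j)
    then show ?thesis using \<phi>x[of i j] step[of i j] nbh[of i j "step i j"] by (auto simp: step_def)
  qed
  have img: "\<phi> v \<in> ?U'" if "v \<in> ?U" for v
    using that
  proof (cases rule: pstate_cases)
    case 1
    show ?thesis
    proof (cases so)
      case None
      then show ?thesis using 1 \<phi>s a' by (auto simp: pstate_s)
    next
      case (Some p)
      then have p: "p \<in> I" "p \<in> R" "\<not> f p" using so RL by blast+
      \<comment> \<open>A path that is a single edge takes the guard of \<open>s\<close> straight to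
        \<open>t\<close>, so \<open>so\<close> and \<open>ti\<close> then name the same
        path.\<close>
      show ?thesis
      proof (cases "len p = 1")
        case True
        then have "ti = Some p" using p ti[of p] by auto
        then show ?thesis using True 1 Some p \<phi>s b' x_len[of p] by (simp add: pstate_t)
      next
        case False
        then show ?thesis using 1 Some p \<phi>s len_pos[of p] f' by (simp add: pstate_inner)
      qed
    qed
  next
    case 2
    show ?thesis
    proof (cases tt)
      case None
      then show ?thesis using 2 \<phi>t b' by (auto simp: pstate_t)
    next
      case (Some p)
      then have p: "p \<in> I" "p \<in> L" "odd (len p) = f p" using tt RL by blast+
      show ?thesis
      proof (cases "len p = 1")
        case True
        then have "si = Some p" using p si[of p] by auto
        then show ?thesis using True 2 Some p \<phi>t a' x_0[of p] by (simp add: pstate_s)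
      next
        case False
        then show ?thesis using 2 Some p \<phi>t len_pos[of p] f' by (simp add: pstate_inner)
      qed
    qed
  next
    case (3 i j)
    note st = step[OF 3(2-4)]
    consider "step i j = 0" | "step i j = len i" | "0 < step i j" "step i j < len i"
      using st(1) by linarith
    then show ?thesis
    proof cases
      case 1
      then have "si = Some i" using st 3 si[of i] by auto
      then show ?thesis using 1 3 \<phi>x a' x_0 by (simp add: pstate_s)
    next
      case 2
      then have "ti = Some i" using st 3 ti[of i] by (metis even_Suc)
      then show ?thesis using 2 3 \<phi>x b' x_len by (simp add: pstate_t)
    next
      case inn: 3
      then show ?thesis using 3 st(4) f' by (auto simp: \<phi>x pstate_inner)
    qed
  qed
  have inj: "inj_on \<phi> ?U"
  proof -
    have s_inner: "\<phi> s \<noteq> \<phi> (x i j)" if "a" and ij: "i \<in> I" "0 < j" "j < len i" "odd j = f i" for i j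
    proof
      assume eq: "\<phi> s = \<phi> (x i j)"
      note st = step[OF ij(1-3)]
      show False
      proof (cases so)
        case None
        then have "x i (step i j) = s" using eq \<phi>s \<phi>x[OF ij(1-3)] by simp
        then have "i \<in> L" "j = 1" using x_eq_s_iff[OF ij(1) st(1)] st(2) by auto
        then have "si = Some i" using si[of i] ij by auto
        then show False using ab that(1) None by simp
      next
        case (Some p)
        then have p: "p \<in> I" "p \<in> R" "\<not> f p" using so RL by blast+
        have eq: "x i (step i j) = x p 1" using eq \<phi>s \<phi>x[OF ij(1-3)] Some by simp
        show False
        proof (cases "len p = 1")
          case True
          then have "ti = Some p" using p ti[of p] by auto
          moreover have "step i j = len i" using eq x_eq_t_iff[OF ij(1) st(1)] True x_len[OF p(1)] by simp
          then have "i \<in> R" "Suc j = len i" using st(3) by auto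
          then have "ti = Some i" using ti[of i] ij by (metis even_Suc)
          ultimately show False using True ij by simp
        next
          case False
          then have "p = i" "step i j = 1"
            using x_eq_iff'[of p 1 i "step i j"] eq p ij st(1) len_pos[of p] by auto
          then show False using p ij by (auto simp: step_def)
        qed
      qed
    qed
    have t_inner: "\<phi> t \<noteq> \<phi> (x i j)" if "b" and ij: "i \<in> I" "0 < j" "j < len i" "odd j = f i" for i j
    proof
      assume eq: "\<phi> t = \<phi> (x i j)"
      note st = step[OF ij(1-3)]
      show False
      proof (cases tt)
        case None
        then have "x i (step i j) = t" using eq \<phi>t \<phi>x[OF ij(1-3)] by simp
        then have "i \<in> R" "Suc j = len i" using x_eq_t_iff[OF ij(1) st(1)] st(3) by auto
        then have "ti = Some i" using ti[of i] ij by (metis even_Suc)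
        then show False using ab that(1) None by simp
      next
        case (Some p)
        then have p: "p \<in> I" "p \<in> L" "odd (len p) = f p" using tt RL by blast+
        have eq: "x i (step i j) = x p (len p - 1)" using eq \<phi>t \<phi>x[OF ij(1-3)] Some by simp
        show False
        proof (cases "len p = 1")
          case True
          then have "si = Some p" using p si[of p] by auto
          moreover have "step i j = 0" using eq x_eq_s_iff[OF ij(1) st(1)] True x_0[OF p(1)] by simp
          then have "i \<in> L" "j = 1" using st(2) by auto
          then have "si = Some i" using si[of i] ij by auto
          ultimately show False using True ij by simp
        next
          case False
          then have "p = i" "step i j = len i - 1"
            using x_eq_iff'[of p "len p - 1" i "step i j"] eq p ij st(1) len_pos[of p] by auto
          moreover have "i \<notin> R" using p RL \<open>p = i\<close> by blast
          ultimately show False using p ij by (auto simp: step_def)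
        qed
      qed
    qed
    have st: "\<phi> s \<noteq> \<phi> t" if "a" "b"
    proof
      assume eq: "\<phi> s = \<phi> t"
      show False
      proof (cases so; cases tt)
        assume "so = None" "tt = None"
        then show False using eq \<phi>s \<phi>t s_neq_t by simp
      next
        fix p assume n: "so = None" and p: "tt = Some p"
        then have p': "p \<in> I" "p \<in> L" "odd (len p) = f p" using tt RL by blast+
        have "x p (len p - 1) = s" using eq \<phi>s \<phi>t n p by simp
        then have "len p = 1" using x_eq_s_iff[OF p'(1), of "len p - 1"] len_pos[of p] p' by simp
        then have "si = Some p" using p' si[of p] by auto
        then show False using ab n that by simp
      next
        fix p assume n: "so = Some p" and p: "tt = None"
        then have p': "p \<in> I" "p \<in> R" "\<not> f p" using so RL by blast+
        have "x p 1 = t" using eq \<phi>s \<phi>t n p by simp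
        then have "len p = 1" using x_eq_t_iff[OF p'(1), of 1] len_pos[of p] p' by simp
        then have "ti = Some p" using p' ti[of p] by auto
        then show False using ab p that by simp
      next
        fix p q assume p: "so = Some p" and q: "tt = Some q"
        then have p': "p \<in> I" "p \<in> R" "\<not> f p" using so RL by blast+
        from q have q': "q \<in> I" "q \<in> L" "odd (len q) = f q" using tt RL by blast+
        have eq: "x p 1 = x q (len q - 1)" using eq \<phi>s \<phi>t p q by simp
        have "p \<noteq> q" using p' q' RL by auto
        show False
        proof (cases "len p = 1")
          case True
          then have "x q (len q - 1) = t" using eq x_len[OF p'(1)] by simp
          then show False using x_eq_t_iff[OF q'(1), of "len q - 1"] len_pos[OF q'(1)] by simp
        next
          case False
          then show False using x_eq_iff[of p 1 q "len q - 1"] eq p' q' len_pos[of p] \<open>p \<noteq> q\<close> by simp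
        qed
      qed
    qed
    have inner_inner: "x i j = x i' j'" if "\<phi> (x i j) = \<phi> (x i' j')"
      and ij: "i \<in> I" "0 < j" "j < len i" "odd j = f i"
      and ij': "i' \<in> I" "0 < j'" "j' < len i'" "odd j' = f i'" for i j i' j'
    proof -
      note st = step[OF ij(1-3)] and st' = step[OF ij'(1-3)]
      have eq: "x i (step i j) = x i' (step i' j')"
        using that(1) \<phi>x[OF ij(1-3)] \<phi>x[OF ij'(1-3)] by simp
      \<comment> \<open>Two interior guards could only meet at \<open>s\<close>, at
        \<open>t\<close>, or inside one path. The first two are excluded since \<open>si\<close> and
        \<open>ti\<close> name at most one path each, the third since \<open>step i\<close> is
        injective on positive positions.\<close>
      consider "step i j = 0" | "step i j = len i" | "0 < step i j" "step i j < len i"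
        using st(1) by linarith
      then show ?thesis
      proof cases
        case 1
        then have "step i' j' = 0" using eq x_0[OF ij(1)] x_eq_s_iff[OF ij'(1) st'(1)] by simp
        then have "si = Some i" "si = Some i'" "j = 1" "j' = 1"
          using 1 st st' si[of i] si[of i'] ij ij' by auto
        then show ?thesis by simp
      next
        case 2
        then have "step i' j' = len i'" using eq x_len[OF ij(1)] x_eq_t_iff[OF ij'(1) st'(1)] by simp
        then have *: "i \<in> R" "Suc j = len i" "i' \<in> R" "Suc j' = len i'" using 2 st st' by auto
        then have "ti = Some i" "ti = Some i'"
          using ti[of i] ti[of i'] ij(4) ij'(4) by (metis even_Suc)+
        moreover from this have "j = j'" using *(2,4) by simp
        ultimately show ?thesis by simp
      next
        case 3
        then have "i = i'" "step i j = step i' j'" using x_eq_iff[of i "step i j" i' "step i' j'"] eq ij(1) ij'(1) st'(1)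
          by auto
        then have "j = j'" using ij(2) ij'(2) by (auto simp: step_def split: if_splits)
        with \<open>i = i'\<close> show ?thesis by simp
      qed
    qed
    show ?thesis
    proof (rule inj_onI)
      fix v w assume v: "v \<in> ?U" and w: "w \<in> ?U" and eq: "\<phi> v = \<phi> w"
      from v show "v = w"
      proof (cases rule: pstate_cases)
        case 1
        from w show ?thesis
          by (cases rule: pstate_cases) (use 1 eq st s_inner in metis)+
      next
        case 2
        from w show ?thesis
          by (cases rule: pstate_cases) (use 2 eq st t_inner in metis)+
      next
        case (3 i j)
        from w show ?thesis
          by (cases rule: pstate_cases) (use 3 eq s_inner t_inner inner_inner in metis)+
      qed
    qed
  qed
  have fin: "finite ?U'" using pstate_subset finite_verts finite_subset by metis
  have "\<phi> ` ?U \<subseteq> ?U'" using img by blast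
  \<comment> \<open>Injectivity and equal cardinality turn the inclusion into equality, so
    surjectivity needs no separate argument.\<close>
  then have "\<phi> ` ?U = ?U'" using card_subset_eq[OF fin] card card_image[OF inj] by metis
  moreover have "x i j \<in> ?U \<and> \<phi> (x i j) = x i (Suc j) \<or> x i (Suc j) \<in> ?U \<and> \<phi> (x i (Suc j)) = x i j"
    using ij(3)
  proof
    assume i: "i \<in> R \<and> odd j = f i"
    show ?thesis
    proof (cases "j = 0")
      case True
      then have "so = Some i" using i so[of i] by auto
      then show ?thesis using True x_0[OF ij(1)] \<phi>s ab by (simp add: pstate_s)
    next
      case False
      then show ?thesis using i ij \<phi>x[of i j] by (simp add: pstate_inner step_def)
    qed
  next
    assume i: "i \<in> L \<and> even j = f i"
    show ?thesis
    proof (cases "Suc j = len i")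
      case True
      then have "tt = Some i" using i tt[of i] by (metis even_Suc)
      then show ?thesis using True[symmetric] x_len[OF ij(1)] \<phi>t ab by (simp add: pstate_t)
    next
      case False
      then have "Suc j < len i" using ij by simp
      then show ?thesis using i ij \<phi>x[of i "Suc j"] RL by (auto simp: pstate_inner step_def)
    qed
  qed
  ultimately show ?thesis using inj legal by (auto simp: defense_def)
qed

definition shifts_to :: "bool \<Rightarrow> bool \<Rightarrow> ('i \<Rightarrow> bool) \<Rightarrow> 'i \<Rightarrow> nat \<Rightarrow>
    (bool \<Rightarrow> bool \<Rightarrow> ('i \<Rightarrow> bool) \<Rightarrow> bool) \<Rightarrow> bool" where
  "shifts_to a b f i j P \<longleftrightarrow> (\<exists>R L so si tt ti. legal_shift a b f R L so si tt ti \<and>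
     (i \<in> R \<and> odd j = f i \<or> i \<in> L \<and> even j = f i) \<and>
     P (si \<noteq> None \<or> a \<and> so = None) (ti \<noteq> None \<or> b \<and> tt = None) (\<lambda>i. f i \<noteq> (i \<in> R \<union> L)))"

text \<open>Eternal defense is reduced to an invariant \<open>P\<close> on the parameters that every
  attack can restore. The common size \<open>K\<close> supplies the equal cardinalities that
  \<open>defense_legal_shift\<close> asks for.\<close>

lemma evc_class_pstates:
  assumes ne: "P a0 b0 f0"
    and cover: "\<And>a b f. P a b f \<Longrightarrow> vertex_cover verts edges (pstate a b f) \<and> card (pstate a b f) = K"
    and move: "\<And>a b f i j. P a b f \<Longrightarrow> i \<in> I \<Longrightarrow> j < len i \<Longrightarrow> shifts_to a b f i j P"
  shows "evc_class verts edges {pstate a b f | a b f. P a b f} K"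
  unfolding evc_class_def
proof (intro conjI ballI allI impI)
  show "{pstate a b f |a b f. P a b f} \<noteq> {}" using ne by blast
next
  fix U assume "U \<in> {pstate a b f |a b f. P a b f}"
  then show "vertex_cover verts edges U" "card U = K" using cover by blast+
next
  fix U v w assume "U \<in> {pstate a b f |a b f. P a b f}" and e: "{v, w} \<in> edges"
  then obtain a b f where U: "U = pstate a b f" and P: "P a b f" by blast
  obtain i j where ij: "i \<in> I" "j < len i" "{v, w} = {x i j, x i (Suc j)}"
    using e by (auto simp: edges_def)
  obtain R L so si tt ti where m: "legal_shift a b f R L so si tt ti"
     "i \<in> R \<and> odd j = f i \<or> i \<in> L \<and> even j = f i"
     "P (si \<noteq> None \<or> a \<and> so = None) (ti \<noteq> None \<or> b \<and> tt = None) (\<lambda>i. f i \<noteq> (i \<in> R \<union> L))"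
    using move[OF P ij(1,2)] by (auto simp: shifts_to_def)
  have "card (pstate a b f) = card (pstate (si \<noteq> None \<or> a \<and> so = None)
      (ti \<noteq> None \<or> b \<and> tt = None) (\<lambda>i. f i \<noteq> (i \<in> R \<union> L)))"
    using cover[OF P] cover[OF m(3)] by simp
  from defense_legal_shift[OF m(1) refl refl refl this ij(1,2) m(2)]
  obtain \<phi> where \<phi>: "defense verts edges U (x i j) (x i (Suc j)) \<phi>"
    "\<phi> ` U = pstate (si \<noteq> None \<or> a \<and> so = None)
      (ti \<noteq> None \<or> b \<and> tt = None) (\<lambda>i. f i \<noteq> (i \<in> R \<union> L))"
    unfolding U by (elim exE conjE)
  have "\<phi> ` U \<in> {pstate a b f |a b f. P a b f}"
    unfolding \<phi>(2) mem_Collect_eq by (intro exI conjI, rule refl, rule m(3))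
  moreover have "v = x i j \<and> w = x i (Suc j) \<or> v = x i (Suc j) \<and> w = x i j"
    using ij(3) by (auto simp: doubleton_eq_iff)
  then have "defense verts edges U v w \<phi>" using \<phi>(1) by (auto simp: defense_def)
  ultimately show "\<exists>\<phi>. defense verts edges U v w \<phi> \<and> \<phi> ` U \<in> {pstate a b f |a b f. P a b f}"
    by blast
qed

end

section \<open>General facts about eternal vertex cover classes\<close>

lemma evc_eqI:
  assumes "evc_class V E \<U> k" and "\<And>\<U> k'. evc_class V E \<U> k' \<Longrightarrow> k \<le> k'"
  shows "evc V E = k"
  unfolding evc_def by (rule Least_equality) (use assms in blast)+

lemma evc_class_member:
  assumes "evc_class V E \<U> k"
  obtains U where "U \<in> \<U>"
  using assms unfolding evc_class_def by auto

lemma evc_class_cover: "evc_class V E \<U> k \<Longrightarrow> U \<in> \<U> \<Longrightarrow> vertex_cover V E U \<and> card U = k"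
  by (simp add: evc_class_def)

lemma evc_class_defense:
  assumes "evc_class V E \<U> k" "U \<in> \<U>" "{v, w} \<in> E"
  obtains \<phi> where "defense V E U v w \<phi>" "\<phi> ` U \<in> \<U>"
  using assms unfolding evc_class_def by meson

text \<open>Swapping the two ends of the attacked edge answers every attack; if the unguarded vertex
  is one of them, it becomes the other one.\<close>

lemma evc_class_all_but_one:
  assumes E: "\<And>e. e \<in> E \<Longrightarrow> \<exists>u v. u \<noteq> v \<and> u \<in> V \<and> v \<in> V \<and> e = {u, v}"
    and fin: "finite V" and ne: "V \<noteq> {}"
  shows "evc_class V E {V - {z} | z. z \<in> V} (card V - 1)"
  unfolding evc_class_def
proof (intro conjI ballI allI impI)
  show "{V - {z} | z. z \<in> V} \<noteq> {}" using ne by blast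
next
  fix U assume "U \<in> {V - {z} | z. z \<in> V}"
  then show "vertex_cover V E U" "card U = card V - 1"
    using E fin by (fastforce simp: vertex_cover_def, auto)
next
  fix U v w assume "U \<in> {V - {z} | z. z \<in> V}" and e: "{v, w} \<in> E"
  then obtain z where U: "U = V - {z}" and z: "z \<in> V" by blast
  have vw: "v \<in> V" "w \<in> V" "v \<noteq> w" using E[OF e] by (auto simp: doubleton_eq_iff)
  define \<phi> where "\<phi> = id(v := w, w := v)"
  have "defense V E U v w \<phi>"
    using vw e U by (auto simp: defense_def closed_nbhd_def \<phi>_def inj_on_def insert_commute)
  moreover have "\<phi> ` U = V - {\<phi> z}"
    using vw z unfolding U by (auto simp: \<phi>_def image_iff)
  moreover have "\<phi> z \<in> V" using vw z by (simp add: \<phi>_def)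
  ultimately show "\<exists>\<phi>. defense V E U v w \<phi> \<and> \<phi> ` U \<in> {V - {z} | z. z \<in> V}" by blast
qed

context melon
begin

lemma finite_evens: "finite evens"
  using finite_I by (simp add: evens_def)

lemma inj_on_path: "i \<in> I \<Longrightarrow> inj_on (x i) {..len i}"
  by (rule inj_onI) (metis x_eq_iff x_eq_s_iff x_eq_t_iff atMost_iff le_neq_implies_less neq0_conv)

subsection \<open>Upper bounds\<close>

lemma shifts_toI:
  assumes "legal_shift a b f R L so si tt ti" "i \<in> R \<and> odd j = f i \<or> i \<in> L \<and> even j = f i"
    "P (si \<noteq> None \<or> a \<and> so = None) (ti \<noteq> None \<or> b \<and> tt = None) (\<lambda>i. f i \<noteq> (i \<in> R \<union> L))"
  shows "shifts_to a b f i j P"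
  unfolding shifts_to_def by (intro exI conjI) (fact assms)+

text \<open>With odd lengths only, the graph is bipartite, and the states satisfying
  \<open>P\<close> are its two colour classes: all even positions (with \<open>s\<close>) or all odd
  positions (with \<open>t\<close>). Each attack exchanges the two classes.\<close>

lemma evc_class_no_even:
  assumes k: "2 \<le> card I" and ev: "evens = {}"
  shows "\<exists>\<U>. evc_class verts edges \<U> (card verts div 2)"
proof -
  define P where "P a b f \<longleftrightarrow> a \<noteq> b \<and> (\<forall>i\<in>I. f i = b)" for a b :: bool and f :: "'i \<Rightarrow> bool"
  have odd_len: "odd (len i)" if "i \<in> I" for i using ev that by (auto simp: evens_def)
  have "evc_class verts edges {pstate a b f | a b f. P a b f} (card verts div 2)"
  proof (rule evc_class_pstates)
    show "P True False (\<lambda>_. False)" by (simp add: P_def)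
  next
    fix a b f assume P: "P a b f"
    have "vertex_cover verts edges (pstate a b f)"
      by (rule vertex_cover_pstate) (use P odd_len len_pos in \<open>force simp: P_def\<close>)+
    moreover have "card (pstate a b f) = card verts div 2"
      using card_pstate[of a b f] P ev by (auto simp: P_def)
    ultimately show "vertex_cover verts edges (pstate a b f) \<and> card (pstate a b f) = card verts div 2" ..
  next
    fix a b f i j assume P: "P a b f" and ij: "i \<in> I" "j < len i"
    \<comment> \<open>The guard on the occupied endpoint passes into path \<open>p\<close>, while
      all other paths shift in the opposite direction. The attack decides whether \<open>i\<close>
      must move with \<open>p\<close> or against it; in the latter case a second path is
      required.\<close>
    obtain p where p: "p \<in> I" "p = i \<longleftrightarrow> even j"
    proof (cases "even j")
      case False
      have "\<not> I \<subseteq> {i}" using k card_mono[of "{i}" I] by auto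
      then show ?thesis using that False by blast
    qed (use ij that in blast)
    show "shifts_to a b f i j P"
    proof (cases b)
      case False
      then show ?thesis using P p ij odd_len
        by (intro shifts_toI[where R = "{p}" and L = "I - {p}" and so = "Some p" and si = None
              and tt = None and ti = "Some p"])
          (auto simp: P_def legal_shift_def)
    next
      case True
      then show ?thesis using P p ij odd_len
        by (intro shifts_toI[where R = "I - {p}" and L = "{p}" and so = None and si = "Some p"
              and tt = "Some p" and ti = None])
          (auto simp: P_def legal_shift_def)
    qed
  qed
  then show ?thesis by blast
qed

text \<open>By \<open>card_pstate\<close> the even path \<open>q\<close> may hold its larger set of
  guards exactly when one of \<open>s\<close> and \<open>t\<close> is empty. With only one endpoint
  occupied, every odd path must guard the neighbour of the empty one, which fixes its parity; with
  both occupied the odd paths are free.\<close>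

lemma evc_class_one_even:
  assumes k: "2 \<le> card I" and ev: "evens = {q}"
  shows "\<exists>\<U>. evc_class verts edges \<U> ((card verts + 1) div 2)"
proof -
  define P where "P a b f \<longleftrightarrow> a \<and> b \<and> \<not> f q \<or> a \<and> \<not> b \<and> f q \<and> (\<forall>i\<in>I - {q}. \<not> f i) \<or>
      \<not> a \<and> b \<and> (\<forall>i\<in>I. f i)" for a b :: bool and f :: "'i \<Rightarrow> bool"
  have q: "q \<in> I" "even (len q)" using ev by (auto simp: evens_def)
  have odd_len: "odd (len i)" if "i \<in> I" "i \<noteq> q" for i using ev that by (auto simp: evens_def)
  have len_q: "2 \<le> len q" using q len_pos[of q] by presburger
  have len_odd: "len i = 1 \<or> 1 < len i" if "i \<in> I" for i using len_pos[OF that] by linarith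
  have ev_if: "{i \<in> evens. R i} = (if R q then {q} else {})" for R using ev by auto
  obtain r where r: "r \<in> I" "r \<noteq> q"
    using k card_mono[of "{q}" I] by fastforce
  have "evc_class verts edges {pstate a b f | a b f. P a b f} ((card verts + 1) div 2)"
  proof (rule evc_class_pstates)
    show "P True True (\<lambda>_. False)" by (simp add: P_def)
  next
    fix a b f assume P: "P a b f"
    have "vertex_cover verts edges (pstate a b f)"
    proof (rule vertex_cover_pstate)
      fix i assume i: "i \<in> I"
      show "a \<or> f i \<and> 1 < len i \<or> b \<and> len i = 1" 
        using P i len_q len_odd[OF i] by (auto simp: P_def)
      show "b \<or> (odd (len i) \<noteq> f i \<and> 1 < len i) \<or> a \<and> len i = 1"
        using P i len_q len_odd[OF i] odd_len[OF i] q by (cases "i = q") (auto simp: P_def)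
    qed
    moreover have "card (pstate a b f) = (card verts + 1) div 2"
      using card_pstate[of a b f] P q(1) by (auto simp: P_def ev_if)
    ultimately show "vertex_cover verts edges (pstate a b f) \<and> card (pstate a b f) = (card verts + 1) div 2" ..
  next
    fix a b f i j assume P: "P a b f" and ij: "i \<in> I" "j < len i"
    consider (both) "a" "b" "\<not> f q" | (s) "a" "\<not> b" "f q" "\<forall>i\<in>I - {q}. \<not> f i"
      | (t) "\<not> a" "b" "\<forall>i\<in>I. f i" using P by (auto simp: P_def)
    then show "shifts_to a b f i j P"
    proof cases
      case both
      \<comment> \<open>Attacks that an odd path answers within its interior keep both endpoints
        occupied. All others empty \<open>s\<close> or \<open>t\<close> and give \<open>q\<close>
        its larger set; the odd paths of the wrong parity then shift along to meet the
        invariant.\<close>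
      consider "i = q" "even j" | "i = q" "odd j" | "i \<noteq> q" "odd j" "f i" | "i \<noteq> q" "odd j" "\<not> f i"
        | "i \<noteq> q" "even j" "f i" | "i \<noteq> q" "even j" "\<not> f i" by blast
      then show ?thesis
      proof cases
        case 1
        then show ?thesis using both q odd_len
          by (intro shifts_toI[where R = "{q}" and L = "{i \<in> I - {q}. \<not> f i}" and so = "Some q"
                and si = None and tt = None and ti = None])
            (auto simp: P_def legal_shift_def)
      next
        case 2
        then show ?thesis using both q odd_len
          by (intro shifts_toI[where R = "{i \<in> I - {q}. f i}" and L = "{q}" and so = None
                and si = None and tt = "Some q" and ti = None])
            (auto simp: P_def legal_shift_def)
      next
        case 3
        then show ?thesis using both q odd_len ij
          by (intro shifts_toI[where R = "{i}" and L = "{}" and so = None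
                and si = None and tt = None and ti = None])
            (auto simp: P_def legal_shift_def)
      next
        case 4
        then show ?thesis using both q odd_len ij
          by (intro shifts_toI[where R = "{}" and L = "{i}" and so = None
                and si = None and tt = None and ti = None])
            (auto simp: P_def legal_shift_def)
      next
        case 5
        then show ?thesis using both q odd_len ij
          by (intro shifts_toI[where R = "insert q {p \<in> I - {q, i}. f p}" and L = "{i}" and so = "Some q"
                and si = "Some i" and tt = "Some i" and ti = None])
            (auto simp: P_def legal_shift_def)
      next
        case 6
        then show ?thesis using both q odd_len ij
          by (intro shifts_toI[where R = "{i}" and L = "insert q {p \<in> I - {q, i}. \<not> f p}" and so = "Some i"
                and si = None and tt = "Some q" and ti = "Some i"])
            (auto simp: P_def legal_shift_def)
      qed
    next
      case s
      show ?thesis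
      proof (cases "odd j")
        case True
        then show ?thesis using s q odd_len ij
          by (intro shifts_toI[where R = "{q}" and L = "{i} - {q}" and so = None
                and si = None and tt = None and ti = "Some q"])
            (auto simp: P_def legal_shift_def)
      next
        case False
        \<comment> \<open>Path \<open>q\<close> gives a guard to \<open>s\<close>, and
          \<open>s\<close> sends one through the odd path \<open>p\<close> towards \<open>t\<close>,
          so afterwards both endpoints are occupied. If the attack hits \<open>q\<close> itself,
          \<open>r\<close> serves as the odd path.\<close>
        define p where "p = (if i = q then r else i)"
        have "p \<in> I" "p \<noteq> q" "i = q \<or> i = p" using r ij by (auto simp: p_def)
        then show ?thesis using False s q odd_len ij
          by (intro shifts_toI[where R = "{p}" and L = "{q}" and so = "Some p"
                and si = "Some q" and tt = None and ti = "Some p"])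
            (auto simp: P_def legal_shift_def)
      qed
    next
      case t
      show ?thesis
      proof (cases "i = q \<longleftrightarrow> even j")
        case True
        then show ?thesis using t q odd_len ij
          by (intro shifts_toI[where R = "{i} - {q}" and L = "{q}" and so = None
                and si = "Some q" and tt = None and ti = None])
            (auto simp: P_def legal_shift_def)
      next
        case False
        define p where "p = (if i = q then r else i)"
        have "p \<in> I" "p \<noteq> q" "i = q \<or> i = p" using r ij by (auto simp: p_def)
        then show ?thesis using False t q odd_len ij
          by (intro shifts_toI[where R = "{q}" and L = "{p}" and so = None
                and si = "Some p" and tt = "Some p" and ti = "Some q"])
            (auto simp: P_def legal_shift_def)
      qed
    qed
  qed
  then show ?thesis by blast
qed

text \<open>Both endpoints stay occupied, which leaves the odd paths free. Exactly one even path
  \<open>q\<close> holds its larger set, and the attacks are met by handing this surplus guard to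
  another even path.\<close>

lemma evc_class_many_even:
  assumes ev: "2 \<le> card evens"
  shows "\<exists>\<U>. evc_class verts edges \<U> ((card verts + 4 - card evens) div 2)"
proof -
  define P where "P a b f \<longleftrightarrow> a \<and> b \<and> (\<exists>q\<in>evens. \<forall>i\<in>evens. f i = (i = q))"
    for a b :: bool and f :: "'i \<Rightarrow> bool"
  have evens: "i \<in> evens \<longleftrightarrow> i \<in> I \<and> even (len i)" for i by (auto simp: evens_def)
  obtain q0 where q0: "q0 \<in> evens" using ev by (cases "evens = {}") auto
  have "evc_class verts edges {pstate a b f | a b f. P a b f} ((card verts + 4 - card evens) div 2)"
  proof (rule evc_class_pstates)
    show "P True True (\<lambda>i. i = q0)" using q0 by (auto simp: P_def)
  next
    fix a b f assume P: "P a b f"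
    then obtain q where q: "a" "b" "q \<in> evens" "\<forall>i\<in>evens. f i = (i = q)" by (auto simp: P_def)
    have "{i \<in> evens. f i} = {q}" "{i \<in> evens. \<not> f i} = evens - {q}" using q by auto
    then have "card (pstate a b f) = (card verts + 4 - card evens) div 2"
      using card_pstate[of a b f] q ev finite_evens by simp
    moreover have "vertex_cover verts edges (pstate a b f)"
      by (rule vertex_cover_pstate) (use q in auto)
    ultimately show "vertex_cover verts edges (pstate a b f) \<and>
      card (pstate a b f) = (card verts + 4 - card evens) div 2" by blast
  next
    fix a b f i j assume P: "P a b f" and ij: "i \<in> I" "j < len i"
    then obtain q where ab: "a" "b" and q: "q \<in> I" "even (len q)" "f q" 
      and fq: "\<And>i. i \<in> I \<Longrightarrow> even (len i) \<Longrightarrow> f i = (i = q)"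
      by (auto simp: P_def evens)
    have "\<not> evens \<subseteq> {q}" using ev card_mono[of "{q}" evens] by auto
    then obtain r where "r \<in> evens" "r \<noteq> q" by blast
    then have r: "r \<in> I" "even (len r)" "r \<noteq> q" by (simp_all add: evens)
    have "\<not> f r" using fq r by simp
    have PI: "P True True f'" if "p \<in> I" "even (len p)"
       "\<And>i. i \<in> I \<Longrightarrow> even (len i) \<Longrightarrow> f' i = (i = p)" for f' p
      using that by (auto simp: P_def evens)
    show "shifts_to a b f i j P"
    proof (cases "even (len i)")
      case True
      \<comment> \<open>The surplus passes from \<open>q\<close> to \<open>p\<close>, through
        \<open>s\<close> if \<open>j\<close> is even and through \<open>t\<close> if
        \<open>j\<close> is odd. This serves attacks on the giving and on the receiving path
        alike.\<close>
      define p where "p = (if i = q then r else i)"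
      have p: "p \<in> I" "p \<noteq> q" "even (len p)" "i = q \<or> i = p" "\<not> f p" 
        using r ij True fq by (auto simp: p_def)
      show ?thesis
      proof (cases "even j")
        case True
        then show ?thesis using p q ab fq
          by (intro shifts_toI[where R = "{p}" and L = "{q}" and so = "Some p"
                and si = "Some q" and tt = None and ti = None])
            (auto simp: legal_shift_def intro!: PI[of p])
      next
        case False
        then show ?thesis using p q ab fq
          by (intro shifts_toI[where R = "{q}" and L = "{p}" and so = None
                and si = None and tt = "Some p" and ti = "Some q"])
            (auto simp: legal_shift_def intro!: PI[of p])
      qed
    next
      case odd: False
      \<comment> \<open>For odd \<open>j\<close> the path \<open>i\<close> shifts within its
        interior. For even \<open>j\<close> it takes a guard from one endpoint and delivers one to
        the other; \<open>q\<close> and \<open>r\<close> restore both endpoints, and the surplus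
        moves from \<open>q\<close> to \<open>r\<close>.\<close>
      consider "odd j" "f i" | "odd j" "\<not> f i" | "even j" "f i" | "even j" "\<not> f i" by blast
      then show ?thesis
      proof cases
        case 1
        then show ?thesis using odd q ab fq ij
          by (intro shifts_toI[where R = "{i}" and L = "{}" and so = None
                and si = None and tt = None and ti = None])
            (auto simp: legal_shift_def intro!: PI[of q])
      next
        case 2
        then show ?thesis using odd q ab fq ij
          by (intro shifts_toI[where R = "{}" and L = "{i}" and so = None
                and si = None and tt = None and ti = None])
            (auto simp: legal_shift_def intro!: PI[of q])
      next
        case 3
        then show ?thesis using odd q r \<open>\<not> f r\<close> ab fq ij
          by (intro shifts_toI[where R = "{q, r}" and L = "{i}" and so = "Some r"
                and si = "Some i" and tt = "Some i" and ti = "Some q"])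
            (auto simp: legal_shift_def intro!: PI[of r])
      next
        case 4
        then show ?thesis using odd q r \<open>\<not> f r\<close> ab fq ij
          by (intro shifts_toI[where R = "{i}" and L = "{q, r}" and so = "Some i"
                and si = "Some q" and tt = "Some r" and ti = "Some i"])
            (auto simp: legal_shift_def intro!: PI[of r])
      qed
    qed
  qed
  then show ?thesis by blast
qed

subsection \<open>Lower bounds\<close>

text \<open>The edges starting at positions \<open>l\<close>, \<open>l + 2\<close>, and so on form a
  matching of \<open>m\<close> edges, each of which demands its own vertex of
  \<open>U\<close>.\<close>

lemma matching_bound:
  assumes U: "vertex_cover verts edges U" and i: "i \<in> I"
  shows "l + 2 * m \<le> Suc (len i) \<Longrightarrow> m \<le> card (U \<inter> x i ` {l..<l + 2 * m})"
proof (induction m)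
  case (Suc m)
  let ?a = "l + 2 * m"
  have inj: "inj_on (x i) {l..<l + 2 * Suc m}"
    by (rule inj_on_subset[OF inj_on_path[OF i]]) (use Suc.prems in auto)
  have "{x i ?a, x i (Suc ?a)} \<in> edges" by (rule edgeI[OF i]) (use Suc.prems in simp)
  then have "{x i ?a, x i (Suc ?a)} \<inter> U \<noteq> {}" using U unfolding vertex_cover_def by blast
  then obtain c where c: "c = ?a \<or> c = Suc ?a" "x i c \<in> U" by auto
  have "x i c \<notin> x i ` {l..<l + 2 * m}"
    using c inj_on_eq_iff[OF inj] by (auto simp: image_iff)
  then have "Suc m \<le> card (insert (x i c) (U \<inter> x i ` {l..<l + 2 * m}))"
    using Suc by simp
  also have "\<dots> \<le> card (U \<inter> x i ` {l..<l + 2 * Suc m})"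
    by (rule card_mono) (use c in auto)
  finally show ?case .
qed simp

text \<open>Guards known to stand at positions \<open>J\<close> off the matching count in addition
  to those demanded by it; the conditions on \<open>l\<close> keep the matching inside the
  interior.\<close>

lemma inner_bound:
  assumes U: "vertex_cover verts edges U" and i: "i \<in> I" and l: "0 < l" "l + 2 * m \<le> len i"
    and J: "J \<subseteq> {0<..<len i}" "J \<inter> {l..<l + 2 * m} = {}" "x i ` J \<subseteq> U"
  shows "m + card J \<le> card (U \<inter> inner i)"
proof -
  have finJ: "finite J" using J(1) finite_subset by blast
  have inj: "inj_on (x i) {0<..<len i}" by (rule inj_on_inner[OF i])
  have "(U \<inter> x i ` {l..<l + 2 * m}) \<inter> x i ` J = {}"
    using inj_onD[OF inj] J l by (fastforce simp: image_iff)
  then have "card (U \<inter> x i ` {l..<l + 2 * m}) + card (x i ` J) =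
      card ((U \<inter> x i ` {l..<l + 2 * m}) \<union> x i ` J)"
    using finJ by (intro card_Un_disjoint[symmetric]) auto
  also have "\<dots> \<le> card (U \<inter> inner i)"
    using J l by (intro card_mono) (auto simp: inner_def)
  finally show ?thesis
    using matching_bound[OF U i, of l m] l card_image[OF inj_on_subset[OF inj J(1)]] by simp
qed

text \<open>The minimum forced by a matching rises by one on an even path if an endpoint is missing
  or the first inner vertex is guarded, and on an odd path if both endpoints are missing. The values
  are doubled so that the sum over all paths involves no halves.\<close>

lemma inner_count:
  assumes U: "vertex_cover verts edges U" and i: "i \<in> I"
  shows "len i - 1 + of_bool (even (len i) \<and> \<not> (s \<in> U \<and> t \<in> U))
      + 2 * of_bool (odd (len i) \<and> s \<notin> U \<and> t \<notin> U)
      + 2 * of_bool (even (len i) \<and> s \<in> U \<and> t \<in> U \<and> x i 1 \<in> U)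
    \<le> 2 * card (U \<inter> inner i) + of_bool (even (len i) \<and> s \<in> U \<and> t \<in> U)"
proof -
  have edge: "x i j \<in> U \<or> x i (Suc j) \<in> U" if "j < len i" for j
    using U edgeI[OF i that] by (auto simp: vertex_cover_def)
  note bound = inner_bound[OF U i]
  have first: "x i 1 \<in> U" if "s \<notin> U" using edge[of 0] len_pos[OF i] x_0[OF i] that by simp
  have last: "x i (len i - 1) \<in> U" if "t \<notin> U"
    using edge[of "len i - 1"] len_pos[OF i] x_len[OF i] that by simp
  show ?thesis
  proof (cases "even (len i)")
    case True
    then obtain h where h: "len i = 2 * Suc h" using len_pos[OF i] by (metis dvdE neq0_conv mult_0_right not0_implies_Suc)
    have "h \<le> card (U \<inter> inner i)" using bound[of 1 h "{}"] h by simp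
    moreover have "h + 1 \<le> card (U \<inter> inner i)" if "x i 1 \<in> U"
      using bound[of 2 h "{1}"] h that by simp
    moreover have "h + 1 \<le> card (U \<inter> inner i)" if "t \<notin> U"
      using bound[of 1 h "{len i - 1}"] h last[OF that] by simp
    ultimately show ?thesis using True h first by (cases "s \<in> U"; cases "t \<in> U") auto
  next
    case False
    then obtain h where h: "len i = 2 * h + 1" by (metis oddE)
    have "h \<le> card (U \<inter> inner i)" using bound[of 1 h "{}"] h by simp
    moreover have "h + 1 \<le> card (U \<inter> inner i)" if "t \<notin> U" "s \<notin> U"
    proof (cases h)
      case 0
      then show ?thesis using edge[of 0] that h x_0[OF i] x_len[OF i] by simp
    next
      case (Suc h')
      \<comment> \<open>Both outermost inner vertices are guarded, and the matching occupies exactly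
        the positions 2 to \<open>len i - 2\<close> between them.\<close>
      then show ?thesis using bound[of 2 h' "{1, len i - 1}"] h last first that by simp
    qed
    ultimately show ?thesis using False h by auto
  qed
qed

lemma cover_count:
  assumes U: "vertex_cover verts edges U"
  shows "card verts + (if s \<in> U \<and> t \<in> U then 0 else card evens)
      + (if s \<notin> U \<and> t \<notin> U then 2 * (card I - card evens) else 0)
      + (if s \<in> U \<and> t \<in> U \<and> (\<exists>i\<in>evens. x i 1 \<in> U) then 2 else 0)
      + 2 * (of_bool (s \<in> U) + of_bool (t \<in> U))
    \<le> 2 * card U + (if s \<in> U \<and> t \<in> U then card evens else 0) + 2"
proof -
  have cnt: "(\<Sum>i\<in>I. of_bool (even (len i) \<and> Q)) = (if Q then card evens else 0)" for Q
    using finite_I by (auto simp: evens_def Int_def)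
  have "card I - card evens = card {i \<in> I. odd (len i)}"
  proof -
    have "I - evens = {i \<in> I. odd (len i)}" by (auto simp: evens_def)
    then show ?thesis using card_Diff_subset[of evens I] finite_evens by (auto simp: evens_def)
  qed
  then have cnt': "(\<Sum>i\<in>I. of_bool (odd (len i) \<and> Q)) = (if Q then card I - card evens else 0)" for Q
    using finite_I by (auto simp: Int_def)
  let ?F = "\<lambda>i. of_bool (even (len i) \<and> s \<in> U \<and> t \<in> U \<and> x i 1 \<in> U) :: nat"
  have ex: "(if s \<in> U \<and> t \<in> U \<and> (\<exists>i\<in>evens. x i 1 \<in> U) then 1 else 0) \<le> (\<Sum>i\<in>I. ?F i)"
  proof (cases "s \<in> U \<and> t \<in> U \<and> (\<exists>i\<in>evens. x i 1 \<in> U)")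
    case True
    then obtain i where "i \<in> I" "?F i = 1" by (auto simp: evens_def)
    then show ?thesis using member_le_sum[of i I ?F] finite_I True by simp
  next
    case False
    show ?thesis unfolding if_not_P[OF False] by simp
  qed
  have card: "card U = of_bool (s \<in> U) + of_bool (t \<in> U) + (\<Sum>i\<in>I. card (U \<inter> inner i))"
  proof -
    have "U \<inter> {s, t} = (if s \<in> U then {s} else {}) \<union> (if t \<in> U then {t} else {})" by auto
    then have "card (U \<inter> {s, t}) = of_bool (s \<in> U) + of_bool (t \<in> U)" using s_neq_t by simp
    then show ?thesis using card_subset_verts[of U] U by (simp add: vertex_cover_def)
  qed
  have "(\<Sum>i\<in>I. len i - 1 + of_bool (even (len i) \<and> \<not> (s \<in> U \<and> t \<in> U))
      + 2 * of_bool (odd (len i) \<and> s \<notin> U \<and> t \<notin> U) + 2 * ?F i)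
    \<le> (\<Sum>i\<in>I. 2 * card (U \<inter> inner i) + of_bool (even (len i) \<and> s \<in> U \<and> t \<in> U))"
    by (rule sum_mono) (rule inner_count[OF U])
  then have "card verts + (if s \<in> U \<and> t \<in> U then 0 else card evens)
      + 2 * (if s \<notin> U \<and> t \<notin> U then card I - card evens else 0) + 2 * (\<Sum>i\<in>I. ?F i)
    \<le> 2 * (\<Sum>i\<in>I. card (U \<inter> inner i)) + (if s \<in> U \<and> t \<in> U then card evens else 0) + 2"
    unfolding sum.distrib sum_distrib_left[symmetric] cnt cnt' card_verts
    by (cases "s \<in> U"; cases "t \<in> U") simp_all
  then show ?thesis using ex card by (auto split: if_splits)
qed

text \<open>Here the lower bound already holds for a single vertex cover; two paths suffice, since
  with neither endpoint guarded at least one odd path pays extra.\<close>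

lemma evc_few_even:
  assumes k: "2 \<le> card I" and ev: "card evens \<le> 1"
  shows "2 * evc verts edges = card verts + card evens"
proof -
  have lb: "card verts + card evens \<le> 2 * k'" if c: "evc_class verts edges \<U> k'" for \<U> k'
  proof -
    obtain U where "U \<in> \<U>" using evc_class_member[OF c] .
    then have "vertex_cover verts edges U" "card U = k'" using evc_class_cover[OF c] by auto
    then show ?thesis using cover_count[of U] ev k by (auto split: if_splits)
  qed
  consider "evens = {}" | q where "evens = {q}"
    using ev finite_evens by (metis One_nat_def card_0_eq card_1_singletonE le_Suc_eq le_zero_eq)
  then have "\<exists>\<U>. evc_class verts edges \<U> ((card verts + card evens) div 2)"
    by cases (use evc_class_no_even[OF k] evc_class_one_even[OF k] in auto)
  \<comment> \<open>The concrete state only serves to show that the number of vertices plus the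
    number of even paths is even, so that the halving is exact.\<close>
  moreover obtain c where "2 * c = card verts + card evens"
    using card_pstate[of True False "\<lambda>_. True"] by auto
  ultimately obtain \<U> K where K: "evc_class verts edges \<U> K" "2 * K = card verts + card evens"
    by (metis nonzero_mult_div_cancel_left zero_neq_numeral)
  have "evc verts edges = K" by (rule evc_eqI[OF K(1)]) (use lb K(2) in force)
  then show ?thesis using K(2) by simp
qed

text \<open>The bound on single covers is one too small here. Covers attaining it contain
  \<open>s\<close> and avoid all first vertices of even paths, so the answer to an attack on such a
  first edge, which must move the guard of \<open>s\<close> there, leaves the class.\<close>

lemma evc_many_even:
  assumes k: "3 \<le> card I" and ev: "2 \<le> card evens"
  shows "2 * evc verts edges + card evens = card verts + 4"
proof -
  have le: "card evens \<le> card I" using finite_I by (auto simp: evens_def intro: card_mono)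
  have lb: "card verts + 4 \<le> 2 * k' + card evens" if c: "evc_class verts edges \<U> k'" for \<U> k'
  proof (rule ccontr)
    assume "\<not> ?thesis"
    \<comment> \<open>The parity just recalled sharpens the strict inequality by one more, down to
      the size of a minimum cover.\<close>
    moreover obtain c where "2 * c = card verts + card evens"
      using card_pstate[of True False "\<lambda>_. True"] by auto
    ultimately have small: "2 * k' + card evens \<le> card verts + 2" by presburger
    have U: "s \<in> U \<and> (\<forall>i\<in>evens. x i 1 \<notin> U)" if "U \<in> \<U>" for U
    proof -
      have "vertex_cover verts edges U" "card U = k'" using c that by (auto simp: evc_class_def)
      then show ?thesis using cover_count[of U] small ev k le by (auto split: if_splits)
    qed
    obtain U where "U \<in> \<U>" using evc_class_member[OF c] .
    obtain i where i: "i \<in> evens" using ev by (cases "evens = {}") auto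
    then have "{s, x i 1} \<in> edges" using x_0[of i] len_pos[of i] edgeI[of i 0]
      by (simp add: evens_def)
    then obtain \<phi> where "defense verts edges U s (x i 1) \<phi>" "\<phi> ` U \<in> \<U>"
      using evc_class_defense[OF c \<open>U \<in> \<U>\<close>] by blast
    moreover from this have "\<phi> s = x i 1"
      using U[OF \<open>U \<in> \<U>\<close>] i by (simp add: defense_def)
    ultimately show False using U[OF \<open>U \<in> \<U>\<close>] U[of "\<phi> ` U"] i by (metis imageI)
  qed
  obtain \<U> K where K: "evc_class verts edges \<U> K" "K = (card verts + 4 - card evens) div 2"
    using evc_class_many_even[OF ev] by blast
  have "2 * K \<le> card verts + 4 - card evens" using K(2) by simp
  \<comment> \<open>The state without endpoints yields that there are at most as many even paths as
    vertices, so the truncated subtraction in \<open>K\<close> is exact.\<close>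
  then have eq: "2 * K + card evens = card verts + 4" using lb[OF K(1)]
      card_pstate[of False False "\<lambda>_. False"] by simp
  have "evc verts edges = K" by (rule evc_eqI[OF K(1)]) (use lb eq in force)
  then show ?thesis using eq by simp
qed

text \<open>Repeated attacks on the edge behind the guarded initial segment push the guards together
  until only the last vertex may be free.\<close>

lemma evc_single_path:
  assumes k: "card I = 1"
  shows "evc verts edges = card verts - 1"
proof (rule evc_eqI)
  show "evc_class verts edges {verts - {z} |z. z \<in> verts} (card verts - 1)"
    by (rule evc_class_all_but_one[OF edges_in_verts finite_verts]) (auto simp: verts_def)
next
  fix \<U> k' assume c: "evc_class verts edges \<U> k'"
  obtain i where I: "I = {i}" using k card_1_singletonE by blast
  then have i: "i \<in> I" by simp
  have n: "card verts - 1 = len i" using card_verts I len_pos[OF i] by simp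
  have inj: "x i a = x i b \<longleftrightarrow> a = b" if "a \<le> len i" "b \<le> len i" for a b
    using inj_on_eq_iff[OF inj_on_path[OF i]] that by auto
  have nb: "w \<in> x i ` {..Suc a}" if "w \<in> closed_nbhd verts edges (x i a)" "a < len i" for a w
  proof (cases "w = x i a")
    case False
    then have "{x i a, w} \<in> edges" using that by (simp add: closed_nbhd_def)
    then obtain i' j where "i' \<in> I" "j < len i'" "{x i a, w} = {x i' j, x i' (Suc j)}"
      unfolding edges_def by blast
    then have j: "j < len i" "{x i a, w} = {x i j, x i (Suc j)}" using I by auto
    then have "x i a = x i j \<and> w = x i (Suc j) \<or> x i a = x i (Suc j) \<and> w = x i j"
      by (auto simp: doubleton_eq_iff)
    then show ?thesis using inj that(2) j(1) by auto
  qed auto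
  have "\<exists>U\<in>\<U>. x i ` {..<p} \<subseteq> U" if "p \<le> len i" for p
    using that
  proof (induction p)
    case 0
    then show ?case using c by (auto simp: evc_class_def)
  next
    case (Suc p)
    then obtain U where U: "U \<in> \<U>" "x i ` {..<p} \<subseteq> U" by auto
    show ?case
    proof (cases "x i p \<in> U")
      case True
      then show ?thesis using U by (intro bexI[of _ U]) (auto simp: lessThan_Suc)
    next
      case False
      have "{x i p, x i (Suc p)} \<in> edges" using Suc.prems edgeI[OF i] by simp
      then obtain \<phi> where \<phi>: "defense verts edges U (x i p) (x i (Suc p)) \<phi>" "\<phi> ` U \<in> \<U>"
        using evc_class_defense[OF c U(1)] by blast
      then have sp: "x i (Suc p) \<in> U" "\<phi> (x i (Suc p)) = x i p" using False by (auto simp: defense_def)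
      let ?Q = "x i ` insert (Suc p) {..<p}"
      have QU: "?Q \<subseteq> U" using U sp by auto
      have injx: "inj_on (x i) {..len i}" by (rule inj_on_path[OF i])
      \<comment> \<open>Pigeonhole: the guards at the first \<open>p\<close> positions cannot get
        beyond position \<open>p\<close>, and the one at \<open>Suc p\<close> steps back to
        \<open>p\<close>. These \<open>Suc p\<close> guards therefore fill all \<open>Suc p\<close>
        positions up to \<open>p\<close>.\<close>
      have "\<phi> ` ?Q \<subseteq> x i ` {..p}"
      proof
        fix w assume "w \<in> \<phi> ` ?Q"
        then consider "w = x i p" | a where "a < p" "w = \<phi> (x i a)" using sp by auto
        then show "w \<in> x i ` {..p}"
        proof cases
          case 2
          then have "w \<in> closed_nbhd verts edges (x i a)" using \<phi>(1) U(2) by (auto simp: defense_def)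
          then show ?thesis using nb[of w a] 2 Suc.prems by fastforce
        qed auto
      qed
      moreover have "card (\<phi> ` ?Q) = Suc p"
      proof -
        have "inj_on \<phi> U" using \<phi>(1) by (simp add: defense_def)
        then have "inj_on \<phi> ?Q" using QU inj_on_subset by blast
        moreover have "inj_on (x i) (insert (Suc p) {..<p})"
          by (rule inj_on_subset[OF injx]) (use Suc.prems in auto)
        ultimately show ?thesis by (simp add: card_image)
      qed
      moreover have "card (x i ` {..p}) = Suc p"
        using card_image[OF inj_on_subset[OF injx, of "{..p}"]] Suc.prems by simp
      ultimately have "\<phi> ` ?Q = x i ` {..p}" by (intro card_subset_eq) auto
      then have "x i ` {..<Suc p} \<subseteq> \<phi> ` U" using QU lessThan_Suc_atMost by blast
      then show ?thesis using \<phi>(2) by blast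
    qed
  qed
  then obtain U where U: "U \<in> \<U>" "x i ` {..<len i} \<subseteq> U" by blast
  have "card U = k'" "U \<subseteq> verts" using evc_class_cover[OF c U(1)] by (simp_all add: vertex_cover_def)
  moreover from this have "finite U" using finite_verts finite_subset by blast
  moreover have "card (x i ` {..<len i}) = len i"
    using card_image[OF inj_on_subset[OF inj_on_path[OF i], of "{..<len i}"]]
    by (simp add: subset_eq)
  ultimately show "card verts - 1 \<le> k'" using card_mono[OF _ U(2)] n by simp
qed

end

subsection \<open>Symmetries and degrees\<close>

context melon
begin

text \<open>Reading every path backwards exchanges \<open>s\<close> and \<open>t\<close>. This
  transfers the degree of \<open>s\<close> to \<open>t\<close> and allows the walks of the program
  to start at either endpoint.\<close>

lemma melon_mirror: "melon I len (\<lambda>i j. x i (len i - j)) t s"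
proof
  fix i i' j j'
  assume "i \<in> I" "i' \<in> I" "0 < j" "j < len i" "0 < j'" "j' < len i'"
    "x i (len i - j) = x i' (len i' - j')"
  then show "i = i' \<and> j = j'" using x_inj[of i i' "len i - j" "len i' - j'"] by auto
qed (use finite_I I_nonempty s_neq_t len_pos x_0 x_len x_inner in auto)

lemma verts_mirror: "melon.verts I len (\<lambda>i j. x i (len i - j)) t s = verts"
proof -
  interpret M: melon I len "\<lambda>i j. x i (len i - j)" t s by (rule melon_mirror)
  have "M.inner i = inner i" for i
  proof -
    have "(\<lambda>j. len i - j) ` {0<..<len i} = {0<..<len i}"
    proof (intro equalityI subsetI)
      fix j assume "j \<in> {0<..<len i}"
      then show "j \<in> (\<lambda>j. len i - j) ` {0<..<len i}" by (intro image_eqI[of _ _ "len i - j"]) auto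
    qed auto
    then show ?thesis unfolding M.inner_def inner_def by (metis image_image)
  qed
  then show ?thesis by (auto simp: M.verts_def verts_def)
qed

lemma edges_mirror: "melon.edges I len (\<lambda>i j. x i (len i - j)) = edges"
proof -
  interpret M: melon I len "\<lambda>i j. x i (len i - j)" t s by (rule melon_mirror)
  show ?thesis
  proof (intro equalityI subsetI)
    fix e assume "e \<in> M.edges"
    then obtain i j where ij: "i \<in> I" "j < len i" "e = {x i (len i - j), x i (len i - Suc j)}"
      by (auto simp: M.edges_def)
    then show "e \<in> edges"
      using edgeI[of i "len i - Suc j"] by (simp add: Suc_diff_Suc insert_commute)
  next
    fix e assume "e \<in> edges"
    then obtain i j where ij: "i \<in> I" "j < len i" "e = {x i j, x i (Suc j)}"
      by (auto simp: edges_def)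
    then show "e \<in> M.edges"
      using M.edgeI[of i "len i - Suc j"] by (simp add: Suc_diff_Suc insert_commute)
  qed
qed

lemma edge_cases:
  assumes "{u, v} \<in> edges"
  obtains i j where "i \<in> I" "j < len i" "u = x i j" "v = x i (Suc j)"
    | i j where "i \<in> I" "j < len i" "u = x i (Suc j)" "v = x i j"
  using assms by (auto simp: edges_def doubleton_eq_iff)

lemma neighbours_inner:
  assumes "i \<in> I" "0 < j" "j < len i"
  shows "{v. {x i j, v} \<in> edges} = {x i (j - 1), x i (Suc j)}"
proof (intro equalityI subsetI)
  fix v assume "v \<in> {v. {x i j, v} \<in> edges}"
  then have "{x i j, v} \<in> edges" by simp
  then show "v \<in> {x i (j - 1), x i (Suc j)}"
  proof (cases rule: edge_cases)
    case (1 i' j')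
    then show ?thesis using x_eq_iff[OF assms 1(1), of j'] by auto
  next
    case (2 i' j')
    then show ?thesis using x_eq_iff[OF assms 2(1), of "Suc j'"] by auto
  qed
next
  fix v assume "v \<in> {x i (j - 1), x i (Suc j)}"
  then show "v \<in> {v. {x i j, v} \<in> edges}"
    using edgeI[OF assms(1), of "j - 1"] edgeI[OF assms(1,3)] assms by (auto simp: insert_commute)
qed

lemma neighbours_s: "{v. {s, v} \<in> edges} = (\<lambda>i. x i 1) ` I"
proof (intro equalityI subsetI)
  fix v assume "v \<in> {v. {s, v} \<in> edges}"
  then have "{s, v} \<in> edges" by simp
  then show "v \<in> (\<lambda>i. x i 1) ` I"
  proof (cases rule: edge_cases)
    case (1 i j)
    then have "j = 0" using x_eq_s_iff[of i j] by simp
    then show ?thesis using 1 by auto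
  next
    case (2 i j)
    then show ?thesis using x_eq_s_iff[of i "Suc j"] by simp
  qed
next
  fix v assume "v \<in> (\<lambda>i. x i 1) ` I"
  then show "v \<in> {v. {s, v} \<in> edges}" using edgeI[of _ 0] len_pos x_0 by auto
qed

end

text \<open>
  Moving the sink of a cycle back to its predecessor on the path \<open>p\<close> changes the parity of both
  path lengths.
\<close>

lemma (in melon) evc_two_paths:
  assumes k: "card I = 2"
  shows "evc verts edges = (card verts + 1) div 2"
proof (cases "card evens \<le> 1")
  case True
  then show ?thesis using evc_few_even k by (cases "card evens") auto
next
  case False
  obtain p q where I: "I = {p, q}" "p \<noteq> q" using k by (meson card_2_iff)
  have "evens \<subseteq> I" by (auto simp: evens_def)
  then have "evens = I" using False k finite_I by (intro card_seteq) auto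
  then have "p \<in> evens" "q \<in> evens" using I by simp_all
  then have ev: "even (len p)" "even (len q)" by (simp_all add: evens_def)
  have p: "p \<in> I" "2 \<le> len p" and q: "q \<in> I" "2 \<le> len q"
    using I ev len_pos[of p] len_pos[of q] by (auto elim!: evenE)
  \<comment> \<open>Path \<open>p\<close> loses its last edge and \<open>q\<close> gains it: the old
    sink \<open>t\<close> becomes an inner vertex of \<open>q\<close>, and the predecessor of
    \<open>t\<close> on \<open>p\<close> becomes the sink.\<close>
  define len' where "len' = len(p := len p - 1, q := Suc (len q))"
  define x' where "x' = (\<lambda>i j. if i = q \<and> j = Suc (len q) then x p (len p - 1) else x i j)"
  define t' where "t' = x p (len p - 1)"
  have t': "t' \<noteq> s" "t' \<noteq> t" using x_inner[of p "len p - 1"] p by (auto simp: t'_def)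
  interpret M: melon I len' x' s t'
  proof
    fix i i' j j'
    assume a: "i \<in> I" "i' \<in> I" "0 < j" "j < len' i" "0 < j'" "j' < len' i'" "x' i j = x' i' j'"
    then have b: "j \<le> len i" "j' \<le> len i'" "x i j = x i' j'" "j = len i \<Longrightarrow> i = q" "j' = len i' \<Longrightarrow> i' = q"
      using I by (auto simp: len'_def x'_def split: if_splits)
    show "i = i' \<and> j = j'"
      using a(1,2,3,5) b x_eq_iff[of i j i' j'] x_eq_iff[of i' j' i j]
      by (metis le_neq_implies_less)
  next
    fix i j assume a: "i \<in> I" "0 < j" "j < len' i"
    then have b: "j \<le> len i" "x' i j = x i j" "\<not> (i = p \<and> j = len p - 1)"
      using I by (auto simp: len'_def x'_def split: if_splits)
    have "x i j \<noteq> t'" unfolding t'_def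
      using x_eq_iff[OF p(1), of "len p - 1" i j] a(1) b p by auto
    then show "x' i j \<noteq> s \<and> x' i j \<noteq> t'" using x_eq_s_iff[of i j] a b by simp
  qed (use finite_I I_nonempty t' len_pos x_0 I p q in \<open>auto simp: len'_def x'_def t'_def split: if_splits\<close>)
  have inner_p: "inner p = insert t' (M.inner p)"
  proof -
    have "{0<..<len p} = insert (len p - 1) {0<..<len p - 1}" using p by auto
    moreover have "M.inner p = x p ` {0<..<len p - 1}"
      unfolding M.inner_def by (rule image_cong) (simp_all add: len'_def x'_def I(2))
    ultimately show ?thesis by (simp add: inner_def t'_def)
  qed
  have inner_q: "M.inner q = insert t (inner q)"
  proof -
    have "{0<..<Suc (len q)} = insert (len q) {0<..<len q}" using q by auto
    moreover have "M.inner q = x q ` {0<..<Suc (len q)}"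
      unfolding M.inner_def by (rule image_cong) (simp_all add: len'_def x'_def I(2))
    ultimately show ?thesis using x_len[OF q(1)] by (simp add: inner_def)
  qed
  have "(\<Union>i\<in>I. f i) = f p \<union> f q" for f :: "'i \<Rightarrow> 'v set" using I(1) by simp
  then have verts: "M.verts = verts"
    unfolding M.verts_def verts_def using inner_p inner_q by auto
  have edges: "M.edges = edges"
  proof (intro equalityI subsetI)
    fix e assume "e \<in> M.edges"
    then obtain i j where ij: "i \<in> I" "j < len' i" "e = {x' i j, x' i (Suc j)}"
      by (auto simp: M.edges_def)
    show "e \<in> edges"
    proof (cases "i = q \<and> j = len q")
      case True
      then have "e = {x p (len p - 1), x p (Suc (len p - 1))}"
        using ij x_len[OF q(1)] x_len[OF p(1)] p by (auto simp: x'_def)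
      then show ?thesis using edgeI[OF p(1), of "len p - 1"] p by simp
    next
      case False
      then show ?thesis using ij I edgeI[of i j] by (auto simp: len'_def x'_def split: if_splits)
    qed
  next
    fix e assume "e \<in> edges"
    then obtain i j where ij: "i \<in> I" "j < len i" "e = {x i j, x i (Suc j)}"
      by (auto simp: edges_def)
    show "e \<in> M.edges"
    proof (cases "i = p \<and> j = len p - 1")
      case True
      then have "e = {x' q (len q), x' q (Suc (len q))}"
        using ij x_len[OF q(1)] x_len[OF p(1)] p by (auto simp: x'_def)
      then show ?thesis using M.edgeI[OF q(1), of "len q"] by (simp add: len'_def)
    next
      case False
      then show ?thesis using ij I M.edgeI[of i j] by (auto simp: len'_def x'_def split: if_splits)
    qed
  qed
  have odd_lens: "odd (len p - 1)" "odd (Suc (len q))" using ev p(2) by simp_all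
  have "i = p \<or> i = q" if "i \<in> I" for i using that I(1) by blast
  then have "odd (len' i)" if "i \<in> I" for i
    using that odd_lens by (auto simp: len'_def)
  then have "M.evens = {}" by (auto simp: M.evens_def)
  then show ?thesis using M.evc_few_even k unfolding verts edges by auto
qed

text \<open>
  In a simple graph at most one of the paths is a single edge; repeated ones collapse.
\<close>

locale simple_melon = melon +
  assumes one_short: "i \<in> I \<Longrightarrow> i' \<in> I \<Longrightarrow> len i = 1 \<Longrightarrow> len i' = 1 \<Longrightarrow> i = i'"
begin

lemma inj_on_first: "inj_on (\<lambda>i. x i 1) I"
proof (rule inj_onI)
  fix i i' assume a: "i \<in> I" "i' \<in> I" "x i 1 = x i' 1"
  show "i = i'"
  proof (cases "len i = 1 \<and> len i' = 1")
    case False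
    then have "1 < len i \<or> 1 < len i'" using len_pos[OF a(1)] len_pos[OF a(2)] by linarith
    then show ?thesis using a x_eq_iff[of i 1 i' 1] x_eq_iff[of i' 1 i 1] len_pos[OF a(1)] len_pos[OF a(2)]
      by (metis One_nat_def Suc_leI zero_less_one)
  qed (use one_short a in blast)
qed

lemma simple_melon_mirror: "simple_melon I len (\<lambda>i j. x i (len i - j)) t s"
  by (intro simple_melon.intro melon_mirror) (unfold_locales, rule one_short)

text \<open>This total governs the cost of walking along all paths.\<close>

lemma sum_len: "(\<Sum>i\<in>I. len i) + 2 = card verts + card I"
proof -
  have "(\<Sum>i\<in>I. len i) = (\<Sum>i\<in>I. (len i - 1) + 1)"
    by (rule sum.cong) (use len_pos in force)+
  also have "\<dots> = (\<Sum>i\<in>I. len i - 1) + card I" unfolding sum.distrib by simp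
  finally show ?thesis using card_verts by simp
qed

text \<open>All paths but at most one have an inner vertex, and \<open>s\<close> and
  \<open>t\<close> come on top. Thus paths and total length are linear in the number of vertices,
  which the time and word bounds rely on.\<close>

lemma card_I_less: "card I < card verts"
proof -
  have "card {i \<in> I. len i = 1} \<le> 1"
    using one_short finite_I by (intro card_le_Suc0_iff_eq[THEN iffD2, simplified One_nat_def[symmetric]]) auto
  moreover have "card I = card {i \<in> I. len i = 1} + card {i \<in> I. len i \<noteq> 1}"
    using finite_I by (subst card_Un_disjoint[symmetric]) (auto intro: arg_cong[where f = card])
  moreover have "card {i \<in> I. len i \<noteq> 1} \<le> (\<Sum>i\<in>{i \<in> I. len i \<noteq> 1}. len i - 1)"
  proof -
    have "(\<Sum>i\<in>{i \<in> I. len i \<noteq> 1}. 1) \<le> (\<Sum>i\<in>{i \<in> I. len i \<noteq> 1}. len i - 1)"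
    proof (rule sum_mono)
      fix i assume "i \<in> {i \<in> I. len i \<noteq> 1}"
      then show "1 \<le> len i - 1" using len_pos[of i] by auto
    qed
    then show ?thesis by simp
  qed
  moreover have "\<dots> \<le> (\<Sum>i\<in>I. len i - 1)" by (rule sum_mono2) (use finite_I in auto)
  ultimately show ?thesis using card_verts by linarith
qed

end

section \<open>From lists of vertices to indexed paths\<close>

lemma path_edges_conv: "path_edges xs = {{xs ! j, xs ! Suc j} | j. j < length xs - 1}"
  by (auto simp: path_edges_def less_diff_conv)

text \<open>Different indices can name the same path only if it is the single edge between
  \<open>s\<close> and \<open>t\<close>, so dropping repetitions of that edge leaves the graph
  unchanged.\<close>

lemma melon_graph_simple_melon:
  assumes "melon_graph V E"
  obtains I :: "nat set" and len x s t where "simple_melon I len x s t"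
    "V = melon.verts I len x s t" "E = melon.edges I len x"
proof -
  obtain k where k: "1 \<le> k" "k_melon_graph k V E" using assms by (auto simp: melon_graph_def)
  define Q where "Q s t P \<longleftrightarrow> s \<noteq> t \<and>
      (\<forall>i<k. distinct (P i) \<and> length (P i) \<ge> 2 \<and> hd (P i) = s \<and> last (P i) = t) \<and>
      (\<forall>i<k. \<forall>j<k. i \<noteq> j \<longrightarrow> set (P i) \<inter> set (P j) = {s, t}) \<and>
      V = (\<Union>i<k. set (P i)) \<and> E = (\<Union>i<k. path_edges (P i))" for s t P
  have "\<exists>s t P. Q s t P" using k(2) unfolding k_melon_graph_def Q_def .
  then obtain s t P where "Q s t P" by blast
  note Q = this[unfolded Q_def]
  note st = Q[THEN conjunct1] and P = Q[THEN conjunct2, THEN conjunct1, rule_format]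
    and disj = Q[THEN conjunct2, THEN conjunct2, THEN conjunct1, rule_format]
    and V = Q[THEN conjunct2, THEN conjunct2, THEN conjunct2, THEN conjunct1]
    and E = Q[THEN conjunct2, THEN conjunct2, THEN conjunct2, THEN conjunct2]
  \<comment> \<open>Among all indices whose path is a single edge only the smallest is kept.\<close>
  define I where "I = {i. i < k \<and> (length (P i) = 2 \<longrightarrow> (\<forall>j<i. length (P j) \<noteq> 2))}"
  define len where "len i = length (P i) - 1" for i
  define x where "x i j = P i ! j" for i j
  have I: "i < k" if "i \<in> I" for i using that by (simp add: I_def)
  have rep: "\<exists>i'\<in>I. P i' = P i" if "i < k" for i
  proof (cases "length (P i) = 2")
    case True
    define m where "m = (LEAST m. length (P m) = 2)"
    have m: "length (P m) = 2" "m \<le> i" using True by (auto simp: m_def intro: LeastI Least_le)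
    have "length (P j) \<noteq> 2" if "j < m" for j using not_less_Least that unfolding m_def by blast
    then have "m \<in> I" using m that by (simp add: I_def)
    have "P j = [s, t]" if j: "j < k" "length (P j) = 2" for j
    proof -
      obtain a b where "P j = [a, b]" using j(2) by (metis length_0_conv length_Suc_conv numeral_2_eq_2)
      then show ?thesis using P[OF j(1)] by simp
    qed
    then show ?thesis using True m \<open>m \<in> I\<close> that I by metis
  qed (use that in \<open>auto simp: I_def\<close>)
  have x0: "x i 0 = s" and xl: "x i (len i) = t" if "i < k" for i
    using P[OF that] hd_conv_nth[of "P i"] last_conv_nth[of "P i"]
    by (cases "P i = []"; simp add: x_def len_def)+
  have xd: "x i j = x i j' \<longleftrightarrow> j = j'" if "i < k" "j \<le> len i" "j' \<le> len i" for i j j'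
    using P[OF that(1)] that nth_eq_iff_index_eq[of "P i" j j'] by (auto simp: x_def len_def)
  have lp: "0 < len i" if "i < k" for i using P[OF that] by (auto simp: len_def)
  have inn: "x i j \<noteq> s \<and> x i j \<noteq> t" if "i < k" "0 < j" "j < len i" for i j
    using xd[of i j 0] xd[of i j "len i"] x0[of i] xl[of i] that by auto
  have mem: "x i j \<in> set (P i)" if "i < k" "j < len i" for i j
    using that by (auto simp: x_def len_def)
  have "simple_melon I len x s t"
  proof
    show "finite I" by (simp add: I_def)
    show "I \<noteq> {}" using rep[of 0] k by auto
    show "s \<noteq> t" by (rule st)
  next
    fix i assume "i \<in> I"
    then show "0 < len i" "x i 0 = s" "x i (len i) = t" using lp x0 xl I by auto
  next
    fix i j assume "i \<in> I" "0 < j" "j < len i"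
    then show "x i j \<noteq> s \<and> x i j \<noteq> t" using inn I by blast
  next
    fix i i' j j' assume a: "i \<in> I" "i' \<in> I" "0 < j" "j < len i" "0 < j'" "j' < len i'" "x i j = x i' j'"
    have "i = i'"
    proof (rule ccontr)
      assume "i \<noteq> i'"
      then have "x i j \<in> {s, t}" using disj[of i i'] mem[of i j] mem[of i' j'] a I by auto
      then show False using inn[of i j] a I by auto
    qed
    then show "i = i' \<and> j = j'" using xd[of i j j'] a I by auto
  next
    fix i i' assume "i \<in> I" "i' \<in> I" "len i = 1" "len i' = 1"
    moreover from this have "length (P i) = 2" "length (P i') = 2" by (auto simp: len_def)
    ultimately show "i = i'" by (metis (mono_tags, lifting) I_def linorder_neqE_nat mem_Collect_eq)
  qed
  then interpret simple_melon I len x s t .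
  have "V = (\<Union>i\<in>I. set (P i))" unfolding V using rep I by force
  also have "\<dots> = verts"
  proof -
    have "set (P i) = {s, t} \<union> inner i" if "i \<in> I" for i
    proof -
      have "set (P i) = x i ` {..len i}"
        using P[OF I[OF that]] by (auto simp: x_def len_def set_conv_nth image_iff less_eq_Suc_le)
      also have "{..len i} = insert 0 (insert (len i) {0<..<len i})" by auto
      finally show ?thesis using x0 xl I[OF that] by (simp add: inner_def)
    qed
    then show ?thesis using I_nonempty by (auto simp: verts_def)
  qed
  finally have V': "V = verts" .
  have "E = (\<Union>i\<in>I. path_edges (P i))" unfolding E using rep I by (auto; metis)
  also have "\<dots> = edges" unfolding edges_def path_edges_conv by (auto simp: x_def len_def)
  finally have "E = edges" .
  with V' that \<open>simple_melon I len x s t\<close> show ?thesis by blast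
qed

subsection \<open>Running programs\<close>

text \<open>Total correctness with a postcondition on the step count. Since \<open>exec\<close> is
  deterministic, \<open>runs\<close> acts as a weakest precondition and satisfies equations, by
  which the simplifier executes straight-line code symbolically.\<close>

definition runs :: "nat \<Rightarrow> com \<Rightarrow> state \<Rightarrow> (nat \<Rightarrow> state \<Rightarrow> bool) \<Rightarrow> bool" where
  "runs W p \<sigma> Q \<longleftrightarrow> (\<exists>n \<sigma>'. exec W p \<sigma> n \<sigma>' \<and> Q n \<sigma>')"

lemma runs_eq: "exec W p \<sigma> n \<sigma>' \<Longrightarrow> runs W p \<sigma> Q = Q n \<sigma>'"
  unfolding runs_def using exec_deterministic by blast

lemma runs_Const [simp]: "c < W \<Longrightarrow> runs W (Const a c) (r, h) Q = Q 1 (r(a := c), h)"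
  by (rule runs_eq) (rule exec.Const)

lemma runs_Move [simp]: "r b < W \<Longrightarrow> runs W (Move a b) (r, h) Q = Q 1 (r(a := r b), h)"
  by (rule runs_eq) (rule exec.Move)

lemma runs_Add [simp]: "r b + r c < W \<Longrightarrow> runs W (Add a b c) (r, h) Q = Q 1 (r(a := r b + r c), h)"
  by (rule runs_eq) (rule exec.Add)

lemma runs_Sub [simp]: "r b - r c < W \<Longrightarrow> runs W (Sub a b c) (r, h) Q = Q 1 (r(a := r b - r c), h)"
  by (rule runs_eq) (rule exec.Sub)

lemma runs_Load [simp]: "h (r b) < W \<Longrightarrow> runs W (Load a b) (r, h) Q = Q 1 (r(a := h (r b)), h)"
  by (rule runs_eq) (rule exec.Load)

lemma runs_Seq [simp]:
  "runs W (Seq p q) \<sigma> Q = runs W p \<sigma> (\<lambda>m \<sigma>'. runs W q \<sigma>' (\<lambda>n. Q (m + n)))"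
  unfolding runs_def by (blast elim: exec_SeqE intro: exec.Seq)

lemma runs_IfNZ [simp]:
  "runs W (IfNZ a p q) \<sigma> Q = runs W (if fst \<sigma> a \<noteq> 0 then p else q) \<sigma> (\<lambda>n. Q (1 + n))"
proof
  assume "runs W (IfNZ a p q) \<sigma> Q"
  then obtain n \<sigma>' where n: "exec W (IfNZ a p q) \<sigma> n \<sigma>'" "Q n \<sigma>'" unfolding runs_def by blast
  from n(1) obtain m where "n = 1 + m" "exec W (if fst \<sigma> a \<noteq> 0 then p else q) \<sigma> m \<sigma>'"
    by (cases rule: exec_IfNZE) auto
  then show "runs W (if fst \<sigma> a \<noteq> 0 then p else q) \<sigma> (\<lambda>n. Q (1 + n))"
    unfolding runs_def using n(2) by blast
next
  assume "runs W (if fst \<sigma> a \<noteq> 0 then p else q) \<sigma> (\<lambda>n. Q (1 + n))"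
  then obtain n \<sigma>' where n: "exec W (if fst \<sigma> a \<noteq> 0 then p else q) \<sigma> n \<sigma>'" "Q (1 + n) \<sigma>'"
    unfolding runs_def by blast
  then have "exec W (IfNZ a p q) \<sigma> (1 + n) \<sigma>'"
    using exec.IfTrue[of \<sigma> a W p n \<sigma>' q] exec.IfFalse[of \<sigma> a W q n \<sigma>' p] by (auto split: if_splits)
  then show "runs W (IfNZ a p q) \<sigma> Q" using n(2) unfolding runs_def by blast
qed

text \<open>As a rewrite rule this equation would unfold forever; instances folded to named loops
  are substituted once per round instead.\<close>

lemma runs_WhileNZ:
  "runs W (WhileNZ a p) \<sigma> Q =
    (if fst \<sigma> a \<noteq> 0 then runs W p \<sigma> (\<lambda>m \<sigma>'. runs W (WhileNZ a p) \<sigma>' (\<lambda>n. Q (1 + m + n))) else Q 1 \<sigma>)"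
proof (cases "fst \<sigma> a = 0")
  case True
  then show ?thesis using runs_eq[OF exec.WhileFalse[OF True]] by simp
next
  case False
  have "runs W (WhileNZ a p) \<sigma> Q =
      runs W p \<sigma> (\<lambda>m \<sigma>'. runs W (WhileNZ a p) \<sigma>' (\<lambda>n. Q (1 + m + n)))"
  proof
    assume "runs W (WhileNZ a p) \<sigma> Q"
    then obtain n \<sigma>' where n: "exec W (WhileNZ a p) \<sigma> n \<sigma>'" "Q n \<sigma>'" unfolding runs_def by blast
    from n(1) obtain m \<tau> k where "n = 1 + m + k" "exec W p \<sigma> m \<tau>" "exec W (WhileNZ a p) \<tau> k \<sigma>'"
      by (cases rule: exec_WhileNZE) (use False in auto)
    then show "runs W p \<sigma> (\<lambda>m \<sigma>'. runs W (WhileNZ a p) \<sigma>' (\<lambda>n. Q (1 + m + n)))"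
      unfolding runs_def using n(2) by blast
  next
    assume "runs W p \<sigma> (\<lambda>m \<sigma>'. runs W (WhileNZ a p) \<sigma>' (\<lambda>n. Q (1 + m + n)))"
    then show "runs W (WhileNZ a p) \<sigma> Q"
      unfolding runs_def using exec.WhileTrue[OF False] by blast
  qed
  with False show ?thesis by simp
qed

lemma runs_mono: "runs W p \<sigma> Q \<Longrightarrow> (\<And>n \<sigma>'. Q n \<sigma>' \<Longrightarrow> Q' n \<sigma>') \<Longrightarrow> runs W p \<sigma> Q'"
  unfolding runs_def by blast

fun seq :: "com list \<Rightarrow> com" where
  "seq [] = Skip" |
  "seq [p] = p" |
  "seq (p # q # ps) = Seq p (seq (q # ps))"

subsection \<open>The program\<close>

text \<open>
  Registers: 0 result, 1 number of vertices, 2 twice (number of paths minus one, later two),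
  3 and 4 the constants 1 and 2, 5 the source (in the search: its number plus one), 6 and 7 the
  remaining part of the list of its neighbours, 8 and 9 loop flags, 10 number of even paths,
  12 and 13 previous and current vertex of a walk, 14 parity of its length, 15 to 17 scratch;
  finally 15 holds twice the result, or one less on an odd cycle.
\<close>

definition halve_loop :: com where
  "halve_loop = WhileNZ 15 (seq [Add 0 0 3, Sub 15 15 4])"

text \<open>A degree is the difference of two consecutive list addresses. With truncation, 1 -
  (degree - 2) vanishes exactly for degree at least three, which gives the loop flag.\<close>

definition find_loop :: com where
  "find_loop = WhileNZ 9 (seq [Add 5 5 3, Load 6 5, Add 15 5 3, Load 7 15, Sub 8 7 6, Sub 8 8 4, Sub 9 3 8])"

text \<open>
  A vertex of degree two is left through the sum of its two neighbours minus the previous vertex.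
\<close>

definition walk_loop :: com where
  "walk_loop = WhileNZ 8 (seq [Add 15 13 3, Load 16 15, Add 15 15 3, Load 17 15, Sub 17 17 16, Sub 17 17 4,
     IfNZ 17 (Const 8 0)
       (seq [Load 15 16, Add 16 16 3, Load 16 16, Add 15 15 16, Sub 15 15 12, Move 12 13, Move 13 15,
         Sub 14 3 14])])"

text \<open>The parity register starts at 1 because loading a neighbour of the source is already the
  first step of the walk; subtracting it from 1 afterwards turns it into the contribution of an even
  path.\<close>

definition scan_loop :: com where
  "scan_loop = WhileNZ 9 (seq [Move 12 5, Load 13 6, Const 14 1, Const 8 1, walk_loop,
     Sub 14 3 14, Add 10 10 14, Add 6 6 3, Sub 9 7 6])"

definition twice_evc :: com where
  "twice_evc = seq [Sub 15 10 3, IfNZ 15 (seq [Add 15 1 4, Add 15 15 4, Sub 15 15 10]) (Add 15 1 10)]"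

definition count_even_paths :: com where
  "count_even_paths = seq [Const 5 0, Const 9 1, find_loop, Sub 5 5 3, Const 10 0, Sub 9 7 6, scan_loop,
     twice_evc]"

text \<open>With \<open>n\<close> vertices and \<open>k\<close> paths, cell \<open>n + 1\<close>
  holds the end address of the input, \<open>3 * n + 2 * k - 2\<close>. Three subtractions of
  \<open>n\<close> leave \<open>2 * k - 2\<close>, which is tested against 0 for one path and
  against 2 for two paths.\<close>

definition melon_program :: com where
  "melon_program = seq [Load 1 0, Const 3 1, Const 4 2, Add 5 1 3, Load 2 5, Sub 2 2 1, Sub 2 2 1, Sub 2 2 1,
     IfNZ 2 (seq [Sub 2 2 4, IfNZ 2 count_even_paths (Move 15 1), Const 0 0, halve_loop]) (Sub 0 1 3)]"

section \<open>Correctness and running time of the loops\<close>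

lemmas halve_loop_unfold = runs_WhileNZ[of _ 15 "seq [Add 0 0 3, Sub 15 15 4]", folded halve_loop_def]

lemmas find_loop_unfold = runs_WhileNZ[of _ 9
  "seq [Add 5 5 3, Load 6 5, Add 15 5 3, Load 7 15, Sub 8 7 6, Sub 8 8 4, Sub 9 3 8]",
  folded find_loop_def]

lemmas walk_loop_unfold = runs_WhileNZ[of _ 8 "seq [Add 15 13 3, Load 16 15, Add 15 15 3, Load 17 15,
    Sub 17 17 16, Sub 17 17 4, IfNZ 17 (Const 8 0)
       (seq [Load 15 16, Add 16 16 3, Load 16 16, Add 15 15 16, Sub 15 15 12, Move 12 13, Move 13 15,
         Sub 14 3 14])]", folded walk_loop_def]

lemmas scan_loop_unfold = runs_WhileNZ[of _ 9 "seq [Move 12 5, Load 13 6, Const 14 1, Const 8 1, walk_loop,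
     Sub 14 3 14, Add 10 10 14, Add 6 6 3, Sub 9 7 6]", folded scan_loop_def]

text \<open>Each round trades two units of register 15 for one of register 0; truncation in the last
  round makes the halving round up. The sum of both registers never grows, so the word bound is
  preserved.\<close>

lemma runs_halve_loop:
  assumes "r 3 = 1" "r 4 = 2" "r 0 + r 15 < W"
  shows "runs W halve_loop (r, h) (\<lambda>m \<sigma>. m \<le> 3 * r 15 + 1 \<and> result \<sigma> = r 0 + (r 15 + 1) div 2)"
  using assms
proof (induction "r 15" arbitrary: r rule: less_induct)
  case less
  show ?case
  proof (cases "r 15 = 0")
    case True
    then show ?thesis by (subst halve_loop_unfold) (simp add: result_def)
  next
    case False
    moreover have "Suc (Suc (v - 2) div 2) = Suc v div 2" if "v \<noteq> 0" for v :: nat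
      using that by presburger
    ultimately have "Suc (Suc (r 15 - 2) div 2) = Suc (r 15) div 2" by blast
    with False show ?thesis using less.prems
      by (subst halve_loop_unfold, simp, intro runs_mono[OF less.hyps]) auto
  qed
qed

lemma runs_find_loop:
  assumes "r 3 = 1" "r 4 = 2" "r 9 \<noteq> 0" "r 5 \<le> v" and "\<And>a. h a < W" "v + 2 < W" "1 < W"
    and "3 \<le> h (v + 2) - h (v + 1)"
    and "\<And>u. r 5 \<le> u \<Longrightarrow> u < v \<Longrightarrow> h (u + 2) - h (u + 1) \<le> 2"
  shows "runs W find_loop (r, h) (\<lambda>m \<sigma>. m \<le> 8 * (v - r 5) + 9 \<and>
    (\<exists>r'. \<sigma> = (r', h) \<and> r' 1 = r 1 \<and> r' 3 = 1 \<and> r' 4 = 2 \<and> r' 5 = v + 1 \<and>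
       r' 6 = h (v + 1) \<and> r' 7 = h (v + 2)))"
  using assms(1-4,9)
proof (induction "v - r 5" arbitrary: r)
  case 0
  then have "r 5 = v" by simp
  then show ?case using 0 assms(5-8)
    by (subst find_loop_unfold, simp add: less_imp_diff_less, subst find_loop_unfold, simp)
next
  case (Suc d)
  have "r 5 < v" using Suc.hyps(2) by linarith
  moreover from this have "h (Suc (Suc (r 5))) - Suc (Suc (h (Suc (r 5)))) = 0"
    using Suc.prems(5)[of "r 5"] by simp
  ultimately have u: "r 5 < v" "h (Suc (Suc (r 5))) - Suc (Suc (h (Suc (r 5)))) = 0" by blast+
  show ?case using Suc.prems u Suc.hyps(2) assms(5-7)
    by (subst find_loop_unfold, simp add: less_imp_diff_less, intro runs_mono[OF Suc.hyps(1)]) auto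
qed

text \<open>At position \<open>j\<close> the registers hold the vertices \<open>y (j - 1)\<close>
  and \<open>y j\<close> and the parity of \<open>j\<close>. The sum of the two neighbours of
  \<open>y j\<close> determines the next vertex, and \<open>2 * B + 2 < W\<close> makes this sum fit
  into a word.\<close>

lemma runs_walk_loop:
  assumes bound: "\<And>a. h a < B" "2 * B + 2 < W" "\<And>j. j \<le> l \<Longrightarrow> y j < B"
    and inner: "\<And>j. 0 < j \<Longrightarrow> j < l \<Longrightarrow> h (y j + 2) - h (y j + 1) = 2 \<and>
      h (h (y j + 1)) + h (h (y j + 1) + 1) = y (j - 1) + y (j + 1)"
    and sink: "3 \<le> h (y l + 2) - h (y l + 1)"
    and "0 < j" "j \<le> l" "r 3 = 1" "r 4 = 2" "r 8 \<noteq> 0" "r 12 = y (j - 1)" "r 13 = y j"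
      "r 14 = of_bool (odd j)"
  shows "runs W walk_loop (r, h) (\<lambda>m \<sigma>. m \<le> 16 * (l - j) + 10 \<and>
    (\<exists>r'. \<sigma> = (r', h) \<and> r' 1 = r 1 \<and> r' 3 = 1 \<and> r' 4 = 2 \<and> r' 5 = r 5 \<and> r' 6 = r 6 \<and> r' 7 = r 7 \<and>
       r' 10 = r 10 \<and> r' 14 = of_bool (odd l)))"
  using assms(6-)
proof (induction "l - j" arbitrary: r j)
  case 0
  then have "j = l" by simp
  have hW: "h a < W" "y l + 2 < W" "1 < W" for a using bound(1)[of a] bound(2) bound(3)[of l] by auto
  have "Suc (Suc (h (Suc (y l)))) < h (Suc (Suc (y l)))" using sink by simp
  then show ?case using 0 \<open>j = l\<close> hW
    by (cases "odd l"; subst walk_loop_unfold, simp add: less_imp_diff_less,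
        subst walk_loop_unfold, simp)
next
  case (Suc d)
  have j: "0 < j" "j < l" using Suc by auto
  have yj: "y (j - 1) < B" using bound(3)[of "j - 1"] j by simp
  have hW: "h a < W" "h a + 1 < W" "y j + 2 < W" "y (j - 1) < W" "y (j + 1) < W" "1 < W"
     "y (j - 1) + y (j + 1) < W" for a
    using bound(1)[of a] bound(2) bound(3)[of j] yj bound(3)[of "j + 1"] j by simp_all
  define Post where "Post = (\<lambda>m (\<sigma> :: state). m \<le> 16 * (l - j) + 10 \<and>
    (\<exists>r'. \<sigma> = (r', h) \<and> r' 1 = r 1 \<and> r' 3 = 1 \<and> r' 4 = 2 \<and> r' 5 = r 5 \<and> r' 6 = r 6 \<and> r' 7 = r 7 \<and>
       r' 10 = r 10 \<and> r' 14 = of_bool (odd l)))"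
  \<comment> \<open>The sixteen successors account for the loop test, the branch and the
    instructions of one round at an inner vertex.\<close>
  have rec: "runs W walk_loop (q, h) (\<lambda>n. Post (Suc (Suc (Suc (Suc (Suc (Suc (Suc (Suc (Suc (Suc (Suc (Suc (Suc (Suc (Suc (Suc (n))))))))))))))))))"
    if q: "q 1 = r 1" "q 3 = 1" "q 4 = 2" "q 5 = r 5" "q 6 = r 6" "q 7 = r 7" "q 10 = r 10"
      "q 8 \<noteq> 0" "q 12 = y j" "q 13 = y (j + 1)" "q 14 = of_bool (odd (j + 1))" for q
    by (rule runs_mono[OF Suc.hyps(1)[of "j + 1" q]])
      (use q j Suc.hyps(2) in \<open>auto simp: Post_def\<close>)
  have "runs W walk_loop (r, h) Post"
    using Suc.prems(3-) inner[OF j] hW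
    by (cases "even j"; subst walk_loop_unfold, simp add: less_imp_diff_less, intro rec) simp_all
  then show ?case unfolding Post_def .
qed

text \<open>The list \<open>is\<close> names the paths in the order in which the neighbours of the
  source are stored; the induction consumes one path per round.\<close>

lemma runs_scan_loop:
  assumes bound: "\<And>a. h a < B" "2 * B + 2 < W" "\<And>i j. i \<in> set is \<Longrightarrow> j \<le> len i \<Longrightarrow> y i j < B"
    and inner: "\<And>i j. i \<in> set is \<Longrightarrow> 0 < j \<Longrightarrow> j < len i \<Longrightarrow> h (y i j + 2) - h (y i j + 1) = 2 \<and>
      h (h (y i j + 1)) + h (h (y i j + 1) + 1) = y i (j - 1) + y i (j + 1)"
    and sink: "\<And>i. i \<in> set is \<Longrightarrow> 0 < len i \<and> 3 \<le> h (y i (len i) + 2) - h (y i (len i) + 1)"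
    and "r 3 = 1" "r 4 = 2" "r 7 = r 6 + length is" "r 9 = length is"
      "\<And>u. u < length is \<Longrightarrow> h (r 6 + u) = y (is ! u) 1" "\<And>i. i \<in> set is \<Longrightarrow> y i 0 = r 5"
      "r 10 + length is < B" "r 7 < B" "r 5 < B"
  shows "runs W scan_loop (r, h) (\<lambda>m \<sigma>. m \<le> (\<Sum>i\<leftarrow>is. 16 * len i + 19) + 1 \<and>
    (\<exists>r'. \<sigma> = (r', h) \<and> r' 1 = r 1 \<and> r' 3 = 1 \<and> r' 4 = 2 \<and>
       r' 10 = r 10 + length (filter (\<lambda>i. even (len i)) is)))"
  using assms
proof (induction "is" arbitrary: r)
  case Nil
  then show ?case by (subst scan_loop_unfold) simp
next
  case (Cons i "is")
  let ?r = "r(12 := r 5, 13 := h (r 6), 14 := 1, 8 := 1)"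
  have len: "0 < len i" using Cons.prems(5) by simp
  have W: "h a < W" "r 5 < W" "1 < W" for a
    using Cons.prems(1)[of a] Cons.prems(2,14) by auto
  have h6: "h (r 6) = y i 1" using Cons.prems(10)[of 0] by simp
  have walk: "runs W walk_loop (?r, h) (\<lambda>m \<sigma>. m \<le> 16 * (len i - 1) + 10 \<and>
    (\<exists>r'. \<sigma> = (r', h) \<and> r' 1 = ?r 1 \<and> r' 3 = 1 \<and> r' 4 = 2 \<and> r' 5 = ?r 5 \<and> r' 6 = ?r 6 \<and> r' 7 = ?r 7 \<and>
       r' 10 = ?r 10 \<and> r' 14 = of_bool (odd (len i))))"
    by (rule runs_walk_loop[where B = B and y = "y i"])
      (use Cons.prems(1-7) Cons.prems(11)[of i] h6 len in \<open>auto simp: Suc_leI\<close>)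
  define Post where "Post = (\<lambda>n (\<sigma> :: state). n \<le> (\<Sum>i\<leftarrow>i # is. 16 * len i + 19) + 1 \<and>
    (\<exists>r'. \<sigma> = (r', h) \<and> r' 1 = r 1 \<and> r' 3 = 1 \<and> r' 4 = 2 \<and>
       r' 10 = r 10 + length (filter (\<lambda>i. even (len i)) (i # is))))"
  have "runs W walk_loop (?r, h) (\<lambda>m \<sigma>. runs W
      (seq [Sub 14 3 14, Add 10 10 14, Add 6 6 3, Sub 9 7 6]) \<sigma> (\<lambda>n \<sigma>. runs W scan_loop \<sigma>
        (\<lambda>n'. Post (1 + (1 + (1 + (1 + (1 + (m + n))))) + n'))))"
  proof (rule runs_mono[OF walk], elim conjE exE)
    fix m \<sigma> and r' :: "nat \<Rightarrow> nat"
    assume m: "m \<le> 16 * (len i - 1) + 10" and \<sigma>: "\<sigma> = (r', h)"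
      and r': "r' 1 = ?r 1" "r' 3 = 1" "r' 4 = 2" "r' 5 = ?r 5" "r' 6 = ?r 6" "r' 7 = ?r 7"
       "r' 10 = ?r 10" "r' 14 = of_bool (odd (len i))"
    let ?r' = "r'(14 := of_bool (even (len i)), 10 := r 10 + of_bool (even (len i)), 6 := Suc (r 6),
      9 := length is)"
    have IH: "runs W scan_loop (?r', h) (\<lambda>m \<sigma>. m \<le> (\<Sum>i\<leftarrow>is. 16 * len i + 19) + 1 \<and>
     (\<exists>r''. \<sigma> = (r'', h) \<and> r'' 1 = ?r' 1 \<and> r'' 3 = 1 \<and> r'' 4 = 2 \<and>
       r'' 10 = ?r' 10 + length (filter (\<lambda>i. even (len i)) is)))"
    proof (rule Cons.IH)
      fix u assume "u < length is"
      then show "h (?r' 6 + u) = y (is ! u) 1" using Cons.prems(10)[of "Suc u"] by simp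
    qed (use Cons.prems r' in \<open>auto simp: of_bool_def\<close>)
    have "runs W scan_loop (?r', h)
        (\<lambda>n'. Post (1 + (1 + (1 + (1 + (1 + (m + (1 + (1 + (1 + 1)))))))) + n'))"
      by (rule runs_mono[OF IH]) (use m len r' in \<open>auto simp: Post_def algebra_simps\<close>)
    moreover have "1 - of_bool (odd (len i)) = (of_bool (even (len i)) :: nat)" by simp
    moreover have "r 10 + of_bool (even (len i)) < W" "Suc (r 6) < W" "length is < W"
      using Cons.prems(2,8,12,13) by (auto simp: of_bool_def)
    ultimately show "runs W
      (seq [Sub 14 3 14, Add 10 10 14, Add 6 6 3, Sub 9 7 6]) \<sigma> (\<lambda>n \<sigma>. runs W scan_loop \<sigma>
        (\<lambda>n'. Post (1 + (1 + (1 + (1 + (1 + (m + n))))) + n')))"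
      using r' Cons.prems(8) W unfolding \<sigma> by (cases "even (len i)") simp_all
  qed
  then have "runs W scan_loop (r, h) Post"
    using Cons.prems(9) W by (subst scan_loop_unfold) simp
  then show ?case unfolding Post_def .
qed

text \<open>Only facts about the memory enter, through an abstract numbering \<open>y\<close> of the
  path vertices. The graph is plugged in later, for whichever endpoint is found first.\<close>

lemma runs_count_even_paths:
  assumes bound: "\<And>a. h a < B" "2 * B + 2 < W" "\<And>i j. i \<in> set is \<Longrightarrow> j \<le> len i \<Longrightarrow> y i j < B"
    and inner: "\<And>i j. i \<in> set is \<Longrightarrow> 0 < j \<Longrightarrow> j < len i \<Longrightarrow> h (y i j + 2) - h (y i j + 1) = 2 \<and>
      h (h (y i j + 1)) + h (h (y i j + 1) + 1) = y i (j - 1) + y i (j + 1)"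
    and sink: "\<And>i. i \<in> set is \<Longrightarrow> 0 < len i \<and> 3 \<le> h (y i (len i) + 2) - h (y i (len i) + 1)"
    and source: "3 \<le> length is" "h (v + 2) = h (v + 1) + length is"
      "\<And>u. u < length is \<Longrightarrow> h (h (v + 1) + u) = y (is ! u) 1" "\<And>i. i \<in> set is \<Longrightarrow> y i 0 = v"
      "\<And>u. u < v \<Longrightarrow> h (u + 2) - h (u + 1) \<le> 2"
    and "length is < B" "v < B" "n + 4 \<le> B"
    and r: "r 1 = n" "r 3 = 1" "r 4 = 2"
    and e: "e = length (filter (\<lambda>i. even (len i)) is)"
  shows "runs W count_even_paths (r, h) (\<lambda>m \<sigma>. m \<le> 8 * v + (\<Sum>i\<leftarrow>is. 16 * len i + 19) + 20 \<and>
    (\<exists>r'. \<sigma> = (r', h) \<and> r' 3 = 1 \<and> r' 4 = 2 \<and> r' 15 = (if e \<le> 1 then n + e else n + 4 - e)))"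
proof -
  define T where "T = (\<Sum>i\<leftarrow>is. 16 * len i + 19)"
  define Post where "Post = (\<lambda>m (\<sigma> :: state). m \<le> 8 * v + T + 20 \<and>
    (\<exists>r'. \<sigma> = (r', h) \<and> r' 3 = 1 \<and> r' 4 = 2 \<and> r' 15 = (if e \<le> 1 then n + e else n + 4 - e)))"
  have W: "1 < W" "n + 4 < W" "length is < W" "v + 2 < W" and hW: "h a < W" for a
    using assms(2,6,11,12,13) bound(1)[of a] by simp_all
  have e_le: "e \<le> length is" by (simp add: e)
  have last: "runs W twice_evc
      (q, h) (\<lambda>m. Post (a + m))"
    if "a \<le> 8 * v + T + 15" "q 1 = n" "q 3 = 1" "q 4 = 2" "q 10 = e" for q a
  proof (cases "e \<le> 1")
    case True
    then show ?thesis using that W by (simp add: twice_evc_def Post_def)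
  next
    case False
    then show ?thesis using that W e_le by (simp add: twice_evc_def Post_def less_imp_diff_less)
  qed
  have scan: "runs W scan_loop (q, h) (\<lambda>m \<sigma>. runs W
      twice_evc
      \<sigma> (\<lambda>n. Post (a + m + n)))"
    if a: "a \<le> 8 * v + 14" and q: "q 1 = n" "q 3 = 1" "q 4 = 2" "q 5 = v" "q 6 = h (v + 1)" "q 7 = h (v + 2)"
      "q 9 = length is" "q 10 = 0" for q a
  proof -
    have "runs W scan_loop (q, h) (\<lambda>m \<sigma>. m \<le> (\<Sum>i\<leftarrow>is. 16 * len i + 19) + 1 \<and>
      (\<exists>r'. \<sigma> = (r', h) \<and> r' 1 = q 1 \<and> r' 3 = 1 \<and> r' 4 = 2 \<and>
         r' 10 = q 10 + length (filter (\<lambda>i. even (len i)) is)))"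
      by (rule runs_scan_loop[where B = B and y = y]) (use assms q bound(1)[of "v + 2"] in auto)
    then show ?thesis
      by (rule runs_mono) (elim conjE exE, simp only:, intro last, use a q in \<open>auto simp: T_def e\<close>)
  qed
  have "runs W find_loop (r(5 := 0, 9 := 1), h) (\<lambda>m \<sigma>. m \<le> 8 * (v - (r(5 := 0, 9 := 1)) 5) + 9 \<and>
    (\<exists>r'. \<sigma> = (r', h) \<and> r' 1 = (r(5 := 0, 9 := 1)) 1 \<and> r' 3 = 1 \<and> r' 4 = 2 \<and> r' 5 = v + 1 \<and>
       r' 6 = h (v + 1) \<and> r' 7 = h (v + 2)))"
    by (rule runs_find_loop) (use assms W hW in auto)
  then have "runs W find_loop (r(5 := 0, 9 := 1), h) (\<lambda>m \<sigma>. runs W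
      (seq [Sub 5 5 3, Const 10 0, Sub 9 7 6]) \<sigma> (\<lambda>m' \<sigma>. runs W scan_loop \<sigma> (\<lambda>m'' \<sigma>. runs W
      twice_evc
      \<sigma> (\<lambda>n. Post (2 + m + m' + m'' + n)))))"
  proof (rule runs_mono, elim conjE exE)
    fix m \<sigma> and q :: "nat \<Rightarrow> nat"
    assume q: "m \<le> 8 * (v - (r(5 := 0, 9 := 1)) 5) + 9" "\<sigma> = (q, h)" "q 1 = (r(5 := 0, 9 := 1)) 1" "q 3 = 1"
      "q 4 = 2" "q 5 = v + 1" "q 6 = h (v + 1)" "q 7 = h (v + 2)"
    have "runs W scan_loop (q(5 := v, 10 := 0, 9 := length is), h) (\<lambda>m'' \<sigma>. runs W
      twice_evc
      \<sigma> (\<lambda>n. Post ((2 + m + (1 + (1 + 1))) + m'' + n)))"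
      by (rule scan) (use q r in auto)
    then show "runs W (seq [Sub 5 5 3, Const 10 0, Sub 9 7 6]) \<sigma> (\<lambda>m' \<sigma>. runs W scan_loop \<sigma> (\<lambda>m'' \<sigma>. runs W
      twice_evc
      \<sigma> (\<lambda>n. Post (2 + m + m' + m'' + n))))"
      using q W source(2) by simp
  qed
  then have "runs W count_even_paths (r, h) Post"
    using W unfolding count_even_paths_def by (simp add: add.assoc)
  then show ?thesis unfolding Post_def T_def .
qed

text \<open>In the third case the behaviour of \<open>count_even_paths\<close> is a hypothesis with
  time \<open>T\<close> and outcome \<open>z\<close>, which keeps the dispatch on the number of
  paths free of graph arguments.\<close>

lemma runs_melon_program:
  assumes bound: "\<And>a. h a < B" "2 * B + 2 < W" and n: "h 0 = n" "h (n + 1) = 3 * n + 2 * k - 2"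
    "1 \<le> k" "n + 4 \<le> B"
  shows "k = 1 \<Longrightarrow> runs W melon_program (\<lambda>_. 0, h) (\<lambda>m \<sigma>. m \<le> 20 \<and> result \<sigma> = n - 1)"
    and "k = 2 \<Longrightarrow> runs W melon_program (\<lambda>_. 0, h) (\<lambda>m \<sigma>. m \<le> 3 * n + 20 \<and> result \<sigma> = (n + 1) div 2)"
    and "3 \<le> k \<Longrightarrow>
      (\<And>r. r 1 = n \<Longrightarrow> r 3 = 1 \<Longrightarrow> r 4 = 2 \<Longrightarrow> runs W count_even_paths (r, h) (\<lambda>m \<sigma>. m \<le> T \<and>
        (\<exists>r'. \<sigma> = (r', h) \<and> r' 3 = 1 \<and> r' 4 = 2 \<and> r' 15 = z))) \<Longrightarrow> z \<le> n + 4 \<Longrightarrow>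
      runs W melon_program (\<lambda>_. 0, h) (\<lambda>m \<sigma>. m \<le> T + 3 * z + 20 \<and> result \<sigma> = (z + 1) div 2)"
proof -
  have W: "2 < W" "n + 4 < W" and hW: "h a < W" for a
    using bound(1)[of a] bound(2) n(4) by simp_all
  have h1: "h (Suc n) = 3 * n + 2 * k - 2" using n by simp
  have sub: "3 * n + 2 * k - 2 < W" using hW[of "Suc n"] h1 by simp
  show "runs W melon_program (\<lambda>_. 0, h) (\<lambda>m \<sigma>. m \<le> 20 \<and> result \<sigma> = n - 1)" if "k = 1"
    using that W hW n h1 sub unfolding melon_program_def
    by (simp add: less_imp_diff_less result_def)
  show "runs W melon_program (\<lambda>_. 0, h) (\<lambda>m \<sigma>. m \<le> 3 * n + 20 \<and> result \<sigma> = (n + 1) div 2)" if "k = 2"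
    using that W hW n h1 sub unfolding melon_program_def
    apply (simp add: less_imp_diff_less)
    apply (rule runs_mono[OF runs_halve_loop])
    apply auto
    done
  show "runs W melon_program (\<lambda>_. 0, h) (\<lambda>m \<sigma>. m \<le> T + 3 * z + 20 \<and> result \<sigma> = (z + 1) div 2)"
    if k: "3 \<le> k" and cnt: "\<And>r. r 1 = n \<Longrightarrow> r 3 = 1 \<Longrightarrow> r 4 = 2 \<Longrightarrow>
      runs W count_even_paths (r, h) (\<lambda>m \<sigma>. m \<le> T \<and>
        (\<exists>r'. \<sigma> = (r', h) \<and> r' 3 = 1 \<and> r' 4 = 2 \<and> r' 15 = z))" and z: "z \<le> n + 4"
  proof -
    have k2: "2 * k - 2 \<noteq> 0" "2 * k - 2 - 2 \<noteq> 0" "3 * n + 2 * k - 2 - n - n - n = 2 * k - 2" using k by auto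
    show ?thesis
      using k2 W hW n h1 sub unfolding melon_program_def
      apply (simp add: less_imp_diff_less)
      apply (rule runs_mono[OF cnt])
         apply (simp_all)
      apply (elim conjE exE)
      apply simp
      apply (rule runs_mono[OF runs_halve_loop])
      using z
         apply simp_all
      done
  qed
qed

subsection \<open>The input\<close>

definition list_start :: "nat list list \<Rightarrow> nat \<Rightarrow> nat" where
  "list_start adj i = length adj + 2 + length (concat (take i adj))"

lemma list_start_Suc:
  "i < length adj \<Longrightarrow> list_start adj (Suc i) = list_start adj i + length (adj ! i)"
  by (simp add: list_start_def take_Suc_conv_app_nth)

lemma list_start_length: "list_start adj (length adj) = length adj + 2 + length (concat adj)"
  by (simp add: list_start_def)

lemma length_encoding: "length (encoding adj) = length adj + 2 + length (concat adj)"
  by (simp add: encoding_def)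

lemma input_memory:
  assumes "h = snd (input_state adj)"
  shows "h 0 = length adj"
    and "i \<le> length adj \<Longrightarrow> h (i + 1) = list_start adj i"
    and "i < length adj \<Longrightarrow> u < length (adj ! i) \<Longrightarrow> h (list_start adj i + u) = adj ! i ! u"
proof -
  have h: "h a = (if a < length (encoding adj) then encoding adj ! a else 0)" for a
    by (simp add: assms input_state_def)
  show "h 0 = length adj" by (simp add: h length_encoding) (simp add: encoding_def)
  show "h (i + 1) = list_start adj i" if "i \<le> length adj"
    using that by (simp add: h length_encoding)
      (simp add: encoding_def nth_append nth_map list_start_def del: upt_Suc)
  show "h (list_start adj i + u) = adj ! i ! u" if i: "i < length adj" and u: "u < length (adj ! i)"
  proof -
    have c: "concat adj = concat (take i adj) @ adj ! i @ concat (drop (Suc i) adj)"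
      using arg_cong[OF id_take_nth_drop[OF i], of concat] by simp
    have "concat adj ! (length (concat (take i adj)) + u) = adj ! i ! u"
      using u by (simp add: c nth_append)
    moreover have "length (concat (take i adj)) + u < length (concat adj)"
      using u by (simp add: c)
    ultimately show ?thesis
      by (simp add: h length_encoding list_start_def)
        (simp add: encoding_def nth_append del: upt_Suc)
  qed
qed

text \<open>Every stored word is the number of vertices, an address inside the input or its end, or
  the number of a vertex.\<close>

lemma input_memory_le:
  assumes "\<And>i j. i < length adj \<Longrightarrow> j \<in> set (adj ! i) \<Longrightarrow> j < length adj"
  shows "snd (input_state adj) a \<le> length adj + 2 + length (concat adj)"
proof (cases "a < length (encoding adj)")
  case True
  have "v \<le> length adj + 2 + length (concat adj)" if "v \<in> set (encoding adj)" for v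
  proof -
    consider "v = length adj" | i where "v = list_start adj i" "i \<le> length adj"
      | "v \<in> set (concat adj)"
      using \<open>v \<in> set (encoding adj)\<close> unfolding encoding_def list_start_def
      by (auto simp del: upt_Suc)
    then show ?thesis
    proof cases
      case 2
      have "length (concat (take i adj)) \<le> length (concat (take i adj) @ concat (drop i adj))" by simp
      also have "\<dots> = length (concat adj)" by (metis append_take_drop_id concat_append)
      finally show ?thesis using 2 by (simp add: list_start_def)
    next
      case 3
      then obtain ys where "ys \<in> set adj" "v \<in> set ys" by auto
      then obtain i where "i < length adj" "v \<in> set (adj ! i)" by (metis in_set_conv_nth)
      then show ?thesis using assms by fastforce
    qed simp
  qed
  then show ?thesis using True by (simp add: input_state_def)
qed (simp add: input_state_def)

section \<open>Degrees and their sum\<close>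

context simple_melon
begin

lemma degree_s: "card {w. {s, w} \<in> edges} = card I"
  using card_image[OF inj_on_first] by (simp add: neighbours_s)

lemma degree_t: "card {w. {t, w} \<in> edges} = card I"
proof -
  interpret M: simple_melon I len "\<lambda>i j. x i (len i - j)" t s by (rule simple_melon_mirror)
  show ?thesis using M.degree_s by (simp add: edges_mirror)
qed

lemma degree_inner:
  assumes "i \<in> I" "0 < j" "j < len i"
  shows "card {w. {x i j, w} \<in> edges} = 2"
proof -
  have "x i (j - 1) \<noteq> x i (Suc j)" using inj_on_eq_iff[OF inj_on_path[OF assms(1)]] assms by simp
  then show ?thesis by (simp add: neighbours_inner[OF assms])
qed

lemma degree_other: "v \<in> verts \<Longrightarrow> v \<noteq> s \<Longrightarrow> v \<noteq> t \<Longrightarrow> card {w. {v, w} \<in> edges} = 2"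
  using degree_inner by (auto simp: verts_def inner_def)

text \<open>The inner vertices have degree two and both endpoints have one neighbour per path. Hence
  the number of paths can be recovered from the total length of the adjacency lists.\<close>

lemma sum_degrees: "(\<Sum>v\<in>verts. card {w. {v, w} \<in> edges}) + 4 = 2 * card I + 2 * card verts"
proof -
  have st: "{s, t} \<subseteq> verts" by (auto simp: verts_def)
  have "(\<Sum>v\<in>verts. card {w. {v, w} \<in> edges}) =
      (\<Sum>v\<in>verts - {s, t}. card {w. {v, w} \<in> edges}) + (\<Sum>v\<in>{s, t}. card {w. {v, w} \<in> edges})"
    by (rule sum.subset_diff[OF st finite_verts])
  also have "(\<Sum>v\<in>verts - {s, t}. card {w. {v, w} \<in> edges}) = (\<Sum>v\<in>verts - {s, t}. 2)"
    by (rule sum.cong) (use degree_other in auto)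
  also have "(\<Sum>v\<in>{s, t}. card {w. {v, w} \<in> edges}) = 2 * card I"
    using s_neq_t by (simp add: degree_s degree_t)
  finally show ?thesis
    using card_Diff_subset[OF _ st] card_mono[OF finite_verts st] s_neq_t by simp
qed

end

section \<open>The graph as seen through the memory\<close>

locale melon_input = simple_melon +
  fixes vs :: "'b list" and adj :: "nat list list"
  assumes input: "adjacency_lists verts edges vs adj"
begin

lemma vs: "distinct vs" "set vs = verts" "length vs = card verts" "length adj = card verts"
  using input distinct_card[of vs] by (auto simp: adjacency_lists_def)

lemma adj: "i < card verts \<Longrightarrow> distinct (adj ! i) \<and>
    set (adj ! i) = {j. j < card verts \<and> {vs ! i, vs ! j} \<in> edges}"
  using input vs(3) by (simp add: adjacency_lists_def)

lemma bij_vs: "bij_betw ((!) vs) {..<card verts} verts"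
  using bij_betw_nth[OF vs(1) refl vs(2)[symmetric]] vs(3) by simp

lemma edge_verts: "{u, v} \<in> edges \<Longrightarrow> v \<in> verts"
  using edges_in_verts[of "{u, v}"] by (auto simp: doubleton_eq_iff)

lemma length_adj: "i < card verts \<Longrightarrow> length (adj ! i) = card {w. {vs ! i, w} \<in> edges}"
proof -
  assume i: "i < card verts"
  have inj: "inj_on ((!) vs) {..<card verts}" using bij_vs by (rule bij_betw_imp_inj_on)
  have "(!) vs ` set (adj ! i) = {w. {vs ! i, w} \<in> edges}"
    using adj[OF i] bij_betw_imp_surj_on[OF bij_vs] edge_verts by auto
  moreover have "card ((!) vs ` set (adj ! i)) = card (set (adj ! i))"
    by (rule card_image) (rule inj_on_subset[OF inj], use adj[OF i] in auto)
  ultimately show ?thesis using adj[OF i] distinct_card by metis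
qed

lemma length_concat_adj: "length (concat adj) + 4 = 2 * card I + 2 * card verts"
proof -
  have "length (concat adj) = (\<Sum>i<card verts. length (adj ! i))"
    by (simp add: length_concat sum_list_sum_nth vs atLeast0LessThan)
  also have "\<dots> = (\<Sum>i<card verts. card {w. {vs ! i, w} \<in> edges})"
    by (rule sum.cong) (use length_adj in auto)
  also have "\<dots> = (\<Sum>v\<in>verts. card {w. {v, w} \<in> edges})"
    by (rule sum.reindex_bij_betw[OF bij_vs])
  finally show ?thesis using sum_degrees by simp
qed

abbreviation mem :: "nat \<Rightarrow> nat" where
  "mem \<equiv> snd (input_state adj)"

lemma mem:
  "mem 0 = card verts"
  "i \<le> card verts \<Longrightarrow> mem (i + 1) = list_start adj i"
  "i < card verts \<Longrightarrow> u < length (adj ! i) \<Longrightarrow> mem (list_start adj i + u) = adj ! i ! u"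
  using input_memory[OF refl, where adj = adj] vs(4) by auto

lemma mem_degree:
  assumes "i < card verts"
  shows "mem (i + 2) = mem (i + 1) + card {w. {vs ! i, w} \<in> edges}"
  using mem(2)[of i] mem(2)[of "Suc i"] assms list_start_Suc[of i adj] length_adj[OF assms] vs(4)
  by simp

lemma mem_adj:
  assumes "i < card verts" "u < length (adj ! i)"
  shows "mem (mem (i + 1) + u) = adj ! i ! u"
  using mem(2)[of i] mem(3)[OF assms] assms by simp

lemma mem_end: "mem (card verts + 1) = 3 * card verts + 2 * card I - 2"
  using mem(2)[of "card verts"] list_start_length[of adj] length_concat_adj vs(4) by simp

lemma mem_bound: "mem a < 5 * card verts"
proof -
  have "mem a \<le> card verts + 2 + length (concat adj)"
    using input_memory_le[of adj a] adj vs(4) by simp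
  then show ?thesis using length_concat_adj card_I_less by linarith
qed

definition num :: "'b \<Rightarrow> nat" where
  "num = inv_into {..<card verts} ((!) vs)"

lemma num: "v \<in> verts \<Longrightarrow> num v < card verts" "v \<in> verts \<Longrightarrow> vs ! num v = v"
  using inv_into_into[of v "(!) vs" "{..<card verts}"] f_inv_into_f[of v "(!) vs" "{..<card verts}"]
    bij_betw_imp_surj_on[OF bij_vs] by (auto simp: num_def)

lemma num_vs: "i < card verts \<Longrightarrow> num (vs ! i) = i"
  using inv_into_f_f[OF bij_betw_imp_inj_on[OF bij_vs]] by (simp add: num_def)

lemma inj_on_num: "inj_on num verts"
  by (rule inj_on_inverseI[where g = "(!) vs"]) (rule num)

lemma set_adj_num:
  assumes "v \<in> verts"
  shows "set (adj ! num v) = num ` {w. {v, w} \<in> edges}"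
proof -
  have "set (adj ! num v) = {j. j < card verts \<and> {v, vs ! j} \<in> edges}"
    using adj[OF num(1)[OF assms]] num(2)[OF assms] by simp
  also have "\<dots> = num ` {w. {v, w} \<in> edges}"
    using num num_vs edge_verts by (auto simp: image_iff) (metis)
  finally show ?thesis .
qed

text \<open>The sum of the two entries is independent of their order in the adjacency list, so the
  walk works for every admissible input.\<close>

lemma walk_step:
  assumes "i \<in> I" "0 < j" "j < len i"
  shows "mem (num (x i j) + 2) - mem (num (x i j) + 1) = 2 \<and>
    mem (mem (num (x i j) + 1)) + mem (mem (num (x i j) + 1) + 1) =
      num (x i (j - 1)) + num (x i (j + 1))"
proof -
  let ?v = "x i j"
  have v: "?v \<in> verts" using x_in_verts assms by simp
  note n = num[OF v]
  have len2: "length (adj ! num ?v) = 2" using length_adj[OF n(1)] n(2) degree_inner[OF assms] by simp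
  then obtain a b where ab: "adj ! num ?v = [a, b]"
    by (metis length_0_conv length_Suc_conv numeral_2_eq_2)
  have "a \<noteq> b" using adj[OF n(1)] ab by auto
  moreover have "{a, b} = {num (x i (j - 1)), num (x i (j + 1))}"
    using set_adj_num[OF v] ab neighbours_inner[OF assms] by simp
  ultimately have "a + b = num (x i (j - 1)) + num (x i (j + 1))" by (auto simp: doubleton_eq_iff)
  then show ?thesis
    using mem_degree[OF n(1)] n(2) degree_inner[OF assms] mem_adj[OF n(1), of 0] mem_adj[OF n(1), of 1] ab
    by simp
qed

lemma runs_count_even_paths_input:
  assumes W: "10 * card verts + 2 < W" and k: "3 \<le> card I"
    and v: "v < card verts" "vs ! v = s" "\<And>u. u < v \<Longrightarrow> vs ! u \<noteq> s \<and> vs ! u \<noteq> t"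
    and r: "r 1 = card verts" "r 3 = 1" "r 4 = 2"
  shows "runs W count_even_paths (r, mem) (\<lambda>m \<sigma>. m \<le> 70 * card verts + 20 \<and>
    (\<exists>r'. \<sigma> = (r', mem) \<and> r' 3 = 1 \<and> r' 4 = 2 \<and>
      r' 15 = (if card evens \<le> 1 then card verts + card evens else card verts + 4 - card evens)))"
proof -
  let ?L = "adj ! v" and ?g = "\<lambda>i. num (x i 1)"
  have s: "s \<in> verts" by (simp add: verts_def)
  have v_num: "num s = v" using num_vs[OF v(1)] v(2) by simp
  have x1: "x i 1 \<in> verts" if "i \<in> I" for i using x_in_verts[OF that] len_pos[OF that] by simp
  have inj_g: "inj_on ?g I"
    using inj_on_first inj_on_num x1 by (auto simp: inj_on_def)
  have set_L: "set ?L = ?g ` I"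
    using set_adj_num[OF s] v_num neighbours_s by (simp add: image_image)
  \<comment> \<open>Each neighbour of \<open>s\<close> is the first vertex of exactly one path, by
    \<open>inj_on_first\<close>, so its list puts the paths into an order.\<close>
  define ps where "ps = map (inv_into I ?g) ?L"
  have set_ps: "set ps = I" using inj_g by (simp add: ps_def set_L)
  have g_ps: "?g (ps ! u) = ?L ! u" if "u < length ?L" for u
    using f_inv_into_f[of "?L ! u" ?g I] that set_L nth_mem[OF that] by (simp add: ps_def)
  have dist: "distinct ps"
    unfolding ps_def using adj[OF v(1)] inj_on_inv_into[of "set ?L" ?g I] set_L by (simp add: distinct_map)
  have len_ps: "length ps = card I" using distinct_card[OF dist] set_ps by simp
  have sum_ps: "(\<Sum>i\<leftarrow>ps. 16 * len i + 19) = 16 * (\<Sum>i\<in>I. len i) + 19 * card I"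
  proof -
    have "(\<Sum>i\<leftarrow>ps. 16 * len i + 19) = (\<Sum>i\<in>I. 16 * len i + 19)"
      using sum_list_distinct_conv_sum_set[OF dist] set_ps by simp
    then show ?thesis unfolding sum.distrib sum_distrib_left[symmetric] by simp
  qed
  have ev: "card evens = length (filter (\<lambda>i. even (len i)) ps)"
    using distinct_card[of "filter (\<lambda>i. even (len i)) ps"] dist set_ps by (simp add: evens_def)
  have t: "t \<in> verts" by (simp add: verts_def)
  have n4: "4 \<le> card verts" using card_I_less k by simp
  have time: "8 * v + (\<Sum>i\<leftarrow>ps. 16 * len i + 19) + 20 \<le> 70 * card verts + 20"
    using sum_ps v(1) sum_len card_I_less by linarith
  have "runs W count_even_paths (r, mem) (\<lambda>m \<sigma>. m \<le> 8 * v + (\<Sum>i\<leftarrow>ps. 16 * len i + 19) + 20 \<and>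
    (\<exists>r'. \<sigma> = (r', mem) \<and> r' 3 = 1 \<and> r' 4 = 2 \<and>
      r' 15 = (if card evens \<le> 1 then card verts + card evens else card verts + 4 - card evens)))"
  proof (rule runs_count_even_paths[where B = "5 * card verts" and y = "\<lambda>i j. num (x i j)"])
    show "mem a < 5 * card verts" for a by (rule mem_bound)
    show "2 * (5 * card verts) + 2 < W" using W by simp
    show "num (x i j) < 5 * card verts" if "i \<in> set ps" "j \<le> len i" for i j
      using num(1)[OF x_in_verts] that set_ps by fastforce
    show "mem (num (x i j) + 2) - mem (num (x i j) + 1) = 2 \<and>
      mem (mem (num (x i j) + 1)) + mem (mem (num (x i j) + 1) + 1) =
        num (x i (j - 1)) + num (x i (j + 1))" if "i \<in> set ps" "0 < j" "j < len i" for i j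
      by (rule walk_step) (use that set_ps in auto)
    show "0 < len i \<and> 3 \<le> mem (num (x i (len i)) + 2) - mem (num (x i (len i)) + 1)"
      if "i \<in> set ps" for i
      using that set_ps len_pos x_len mem_degree[OF num(1)[OF t]] num(2)[OF t] degree_t k by simp
    show "3 \<le> length ps" using len_ps k by simp
    show "mem (v + 2) = mem (v + 1) + length ps" using mem_degree[OF v(1)] v(2) degree_s len_ps by simp
    show "mem (mem (v + 1) + u) = num (x (ps ! u) 1)" if "u < length ps" for u
      using mem_adj[OF v(1), of u] g_ps[of u] that by (simp add: ps_def)
    show "num (x i 0) = v" if "i \<in> set ps" for i using that set_ps x_0 v_num by simp
    show "mem (u + 2) - mem (u + 1) \<le> 2" if "u < v" for u
    proof -
      have "u < card verts" using that v by simp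
      then have "vs ! u \<in> verts" using bij_betw_apply[OF bij_vs] by simp
      then show ?thesis using mem_degree[of u] degree_other[of "vs ! u"] v(3)[OF that] \<open>u < card verts\<close> by simp
    qed
    show "length ps < 5 * card verts" using len_ps card_I_less by simp
    show "v < 5 * card verts" using v by simp
    show "card verts + 4 \<le> 5 * card verts" using n4 by simp
    show "card evens = length (filter (\<lambda>i. even (len i)) ps)" by (rule ev)
  qed (rule r)+
  then show ?thesis by (rule runs_mono) (use time in auto)
qed

end

text \<open>The three branches of the program match the three formulas for the eternal vertex cover
  number; the loops are linear in the number of vertices by \<open>sum_len\<close> and
  \<open>card_I_less\<close>.\<close>

lemma (in melon_input) melon_program_correct:
  assumes W: "10 * card verts + 2 < W"
  shows "runs W melon_program (input_state adj) (\<lambda>m \<sigma>. m \<le> 100 * card verts \<and> result \<sigma> = evc verts edges)"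
proof -
  have n2: "card I < card verts" "2 \<le> card verts" using card_I_less card_verts by simp_all
  have k1: "1 \<le> card I" using I_nonempty finite_I by (simp add: Suc_le_eq card_gt_0_iff)
  have st: "input_state adj = (\<lambda>_. 0, mem)" by (simp add: input_state_def)
  have B: "2 * (5 * card verts) + 2 < W" "card verts + 4 \<le> 5 * card verts" using W n2 by simp_all
  note prog = runs_melon_program[OF mem_bound B(1) mem(1) mem_end k1 B(2)]
  consider "card I = 1" | "card I = 2" | "3 \<le> card I" using k1 by linarith
  then show ?thesis
  proof cases
    case 1
    show ?thesis
      by (subst st, rule runs_mono[OF prog(1)[OF 1]]) (use 1 n2 evc_single_path in auto)
  next
    case 2
    show ?thesis
      by (subst st, rule runs_mono[OF prog(2)[OF 2]]) (use 2 n2 evc_two_paths in auto)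
  next
    case 3
    define z where "z = (if card evens \<le> 1 then card verts + card evens else card verts + 4 - card evens)"
    \<comment> \<open>With at least three paths, \<open>s\<close> and \<open>t\<close> are the only
      vertices of degree at least three, so the search stops at the smaller of their two
      numbers.\<close>
    define v where "v = (LEAST v. v < card verts \<and> (vs ! v = s \<or> vs ! v = t))"
    have "s \<in> verts" by (simp add: verts_def)
    then have "num s < card verts \<and> (vs ! num s = s \<or> vs ! num s = t)" using num by blast
    then have v: "v < card verts" "vs ! v = s \<or> vs ! v = t"
      using LeastI[of "\<lambda>v. v < card verts \<and> (vs ! v = s \<or> vs ! v = t)" "num s"] by (auto simp: v_def)
    have less: "vs ! u \<noteq> s \<and> vs ! u \<noteq> t" if "u < v" for u
      using not_less_Least[of u "\<lambda>v. v < card verts \<and> (vs ! v = s \<or> vs ! v = t)"] that v(1)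
      by (auto simp: v_def)
    have cnt: "runs W count_even_paths (r, mem) (\<lambda>m \<sigma>. m \<le> 70 * card verts + 20 \<and>
      (\<exists>r'. \<sigma> = (r', mem) \<and> r' 3 = 1 \<and> r' 4 = 2 \<and> r' 15 = z))"
      if r: "r 1 = card verts" "r 3 = 1" "r 4 = 2" for r
      using v(2)
    proof
      assume "vs ! v = s"
      then show ?thesis unfolding z_def
        by (intro runs_count_even_paths_input[OF W 3 v(1) _ less r])
    next
      \<comment> \<open>If the search meets \<open>t\<close> first, the mirrored melon has
        \<open>t\<close> as its source, on the same graph and with the same even paths.\<close>
      assume vt: "vs ! v = t"
      interpret M: melon_input I len "\<lambda>i j. x i (len i - j)" t s vs adj
        by (intro melon_input.intro simple_melon_mirror melon_input_axioms.intro)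
          (use input in \<open>simp add: verts_mirror edges_mirror\<close>)
      have "M.evens = evens" by (simp add: M.evens_def evens_def)
      then show ?thesis
        using M.runs_count_even_paths_input[of W v r] W 3 v(1) vt less r
        unfolding z_def verts_mirror by simp
    qed
    have ev: "card evens \<le> card I" using finite_I by (auto simp: evens_def intro: card_mono)
    have z: "z \<le> card verts + 4" using ev by (simp add: z_def)
    have res: "(z + 1) div 2 = evc verts edges"
      using evc_few_even evc_many_even 3 ev n2 by (cases "card evens \<le> 1") (simp_all add: z_def)
    show ?thesis
      by (subst st, rule runs_mono[OF prog(3)[OF 3 cnt z]]) (use n2 z res in auto)
  qed
qed

text \<open>The base is at least four, so three of its four factors contribute at least 64, which
  outweighs the coefficient 10.\<close>

lemma word_size_bound: "2 \<le> n \<Longrightarrow> 10 * n + 2 < (n + m + 2) ^ 4" for n m :: nat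
proof -
  assume "2 \<le> n"
  then have "4 ^ 3 \<le> (n + m + 2) ^ 3" by (intro power_mono) auto
  then have "(n + m + 2) * 4 ^ 3 \<le> (n + m + 2) * (n + m + 2) ^ 3" by (rule mult_le_mono2)
  then show ?thesis by (simp add: power_Suc[symmetric])
qed

theorem theorem1:
  "\<exists>(p :: com) (c :: nat) (d :: nat).
     \<forall>(V :: nat set) (E :: nat set set) (vs :: nat list) (adj :: nat list list).
       melon_graph V E \<longrightarrow> adjacency_lists V E vs adj \<longrightarrow>
       (\<exists>(n :: nat) (\<sigma> :: state).
          exec ((card V + card E + 2) ^ d) p (input_state adj) n \<sigma> \<and>
          n \<le> c * (card V + card E) \<and>
          result \<sigma> = evc V E)"
proof (rule exI[of _ melon_program], rule exI[of _ 100], rule exI[of _ 4], intro allI impI)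
  fix V :: "nat set" and E :: "nat set set" and vs :: "nat list" and adj :: "nat list list"
  assume melon: "melon_graph V E" and adj: "adjacency_lists V E vs adj"
  from melon obtain I :: "nat set" and len x s t where "simple_melon I len x s t"
    and VE: "V = melon.verts I len x s t" "E = melon.edges I len x"
    by (rule melon_graph_simple_melon)
  then interpret simple_melon I len x s t by simp
  interpret melon_input I len x s t vs adj by unfold_locales (use adj VE in simp)
  have "2 \<le> card V" using card_verts VE(1) by simp
  then have "runs ((card V + card E + 2) ^ 4) melon_program (input_state adj)
      (\<lambda>m \<sigma>. m \<le> 100 * card V \<and> result \<sigma> = evc V E)"
    using melon_program_correct[OF word_size_bound[of "card verts" "card E"]] VE by simp
  then show "\<exists>n \<sigma>. exec ((card V + card E + 2) ^ 4) melon_program (input_state adj) n \<sigma> \<and>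
      n \<le> 100 * (card V + card E) \<and> result \<sigma> = evc V E"
    unfolding runs_def by (auto simp: distrib_left intro: trans_le_add1)
qed

end
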